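(* Let $\zeta_1,\zeta_2,\zeta_3$ be three equi-spaced points on the unit circle $\mathbb{T}$ (i.e. $\zeta_2=\zeta_1\omega$, $\zeta_3=\zeta_1\omega^2$ with $\omega=e^{2\pi i/3}$), and let $\mu=\delta_{\zeta_1}+\delta_{\zeta_2}+\delta_{\zeta_3}$, where $\delta_\zeta$ denotes the unit point mass at $\zeta$. Then the Cauchy dual $M_z'$ of the operator $M_z$ of multiplication by the coordinate function $z$ on the Dirichlet-type space $D(\mu)$ is not subnormal.
   Context: $\mathbb{D}$ is the open unit disc, $\mathbb{T}$ the unit circle, $dA$ the normalized Lebesgue area measure on $\mathbb{D}$. For a finite positive Borel measure $\mu$ on $\mathbb{T}$, $P_\mu(z)=\int_{\mathbb{T}}\frac{1-|z|^2}{|z-\zeta|^2}\,d\mu(\zeta)$ is its Poisson integral, and the Dirichlet-type space is $D(\mu)=\{f \text{ holomorphic on } \mathbb{D}: \int_{\mathbb{D}}|f'(z)|^2P_\mu(z)\,dA(z)<\infty\}$ (such $f$ automatically lie in the Hardy space $H^2$), with norm $\|f\|_\mu^2=\|f\|_{H^2}^2+\int_{\mathbb{D}}|f'(z)|^2P_\mu(z)\,dA(z)$; $M_z f(z)=zf(z)$ is a bounded left-invertible operator on $D(\mu)$. For a left-invertible bounded operator $T$ on a Hilbert space, its Cauchy dual is $T'=T(T^*T)^{-1}$. An operator $T$ on a Hilbert space $\mathcal{H}$ is subnormal if there is a Hilbert space $\mathcal{K}\supseteq\mathcal{H}$ and a normal operator $S$ on $\mathcal{K}$ with $S|_{\mathcal{H}}=T$.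 *)

theory Defs
  imports "HOL-Analysis.Analysis"
begin

definition poisson_int :: "complex measure \<Rightarrow> complex \<Rightarrow> real" where
  "poisson_int \<mu> z = (\<integral>\<zeta>. (1 - (cmod z)\<^sup>2) / (cmod (z - \<zeta>))\<^sup>2 \<partial>\<mu>)"

definition taylor_coeff :: "(complex \<Rightarrow> complex) \<Rightarrow> nat \<Rightarrow> complex" where
  "taylor_coeff f n = (deriv ^^ n) f 0 / of_nat (fact n)"

text \<open>Elements of D(mu) are holomorphic functions on the unit disc; to make them
  unique as HOL functions they are normalised to vanish off the disc.
  The area measure dA is Lebesgue measure on the disc divided by pi.\<close>
definition Dspace :: "complex measure \<Rightarrow> (complex \<Rightarrow> complex) set" where
  "Dspace \<mu> = {f. f holomorphic_on ball 0 1 \<and> (\<forall>z. z \<notin> ball 0 1 \<longrightarrow> f z = 0) \<and>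
      (\<integral>\<^sup>+ z. indicator (ball 0 1) z *
          ennreal ((cmod (deriv f z))\<^sup>2 * poisson_int \<mu> z / pi) \<partial>lborel) < \<infinity>}"

definition D_inner :: "complex measure \<Rightarrow> (complex \<Rightarrow> complex) \<Rightarrow> (complex \<Rightarrow> complex) \<Rightarrow> complex" where
  "D_inner \<mu> f g = (\<Sum>n. taylor_coeff f n * cnj (taylor_coeff g n)) +
     (LINT z : ball 0 1 | lborel. deriv f z * cnj (deriv g z) * complex_of_real (poisson_int \<mu> z / pi))"

definition Mz :: "(complex \<Rightarrow> complex) \<Rightarrow> (complex \<Rightarrow> complex)" where
  "Mz f = (\<lambda>z. z * f z)"

definition chilbert :: "'k set \<Rightarrow> ('k \<Rightarrow> 'k \<Rightarrow> 'k) \<Rightarrow> (complex \<Rightarrow> 'k \<Rightarrow> 'k) \<Rightarrow> 'k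
     \<Rightarrow> ('k \<Rightarrow> 'k \<Rightarrow> complex) \<Rightarrow> bool" where
  "chilbert K add sm zero ip \<longleftrightarrow>
     zero \<in> K \<and>
     (\<forall>x\<in>K. \<forall>y\<in>K. add x y \<in> K) \<and>
     (\<forall>c. \<forall>x\<in>K. sm c x \<in> K) \<and>
     (\<forall>x\<in>K. \<forall>y\<in>K. \<forall>w\<in>K. add (add x y) w = add x (add y w)) \<and>
     (\<forall>x\<in>K. \<forall>y\<in>K. add x y = add y x) \<and>
     (\<forall>x\<in>K. add x zero = x) \<and>
     (\<forall>x\<in>K. add x (sm (-1) x) = zero) \<and>
     (\<forall>x\<in>K. sm 1 x = x) \<and>
     (\<forall>a b. \<forall>x\<in>K. sm a (sm b x) = sm (a * b) x) \<and>
     (\<forall>a b. \<forall>x\<in>K. sm (a + b) x = add (sm a x) (sm b x)) \<and>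
     (\<forall>a. \<forall>x\<in>K. \<forall>y\<in>K. sm a (add x y) = add (sm a x) (sm a y)) \<and>
     (\<forall>x\<in>K. \<forall>y\<in>K. \<forall>w\<in>K. ip (add x y) w = ip x w + ip y w) \<and>
     (\<forall>a. \<forall>x\<in>K. \<forall>y\<in>K. ip (sm a x) y = a * ip x y) \<and>
     (\<forall>x\<in>K. \<forall>y\<in>K. ip y x = cnj (ip x y)) \<and>
     (\<forall>x\<in>K. Im (ip x x) = 0 \<and> Re (ip x x) \<ge> 0) \<and>
     (\<forall>x\<in>K. ip x x = 0 \<longrightarrow> x = zero) \<and>
     (\<forall>X :: nat \<Rightarrow> 'k. (\<forall>n. X n \<in> K) \<and>
          (\<forall>e>0. \<exists>N. \<forall>m\<ge>N. \<forall>n\<ge>N.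
              sqrt (Re (ip (add (X m) (sm (-1) (X n))) (add (X m) (sm (-1) (X n))))) < e)
        \<longrightarrow> (\<exists>x\<in>K. \<forall>e>0. \<exists>N. \<forall>n\<ge>N.
              sqrt (Re (ip (add (X n) (sm (-1) x)) (add (X n) (sm (-1) x)))) < e))"

definition bounded_op :: "'k set \<Rightarrow> ('k \<Rightarrow> 'k \<Rightarrow> 'k) \<Rightarrow> (complex \<Rightarrow> 'k \<Rightarrow> 'k)
     \<Rightarrow> ('k \<Rightarrow> 'k \<Rightarrow> complex) \<Rightarrow> ('k \<Rightarrow> 'k) \<Rightarrow> bool" where
  "bounded_op K add sm ip S \<longleftrightarrow>
     (\<forall>x\<in>K. S x \<in> K) \<and>
     (\<forall>x\<in>K. \<forall>y\<in>K. S (add x y) = add (S x) (S y)) \<and>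
     (\<forall>c. \<forall>x\<in>K. S (sm c x) = sm c (S x)) \<and>
     (\<exists>C. \<forall>x\<in>K. Re (ip (S x) (S x)) \<le> C * Re (ip x x))"

definition normal_op :: "'k set \<Rightarrow> ('k \<Rightarrow> 'k \<Rightarrow> 'k) \<Rightarrow> (complex \<Rightarrow> 'k \<Rightarrow> 'k)
     \<Rightarrow> ('k \<Rightarrow> 'k \<Rightarrow> complex) \<Rightarrow> ('k \<Rightarrow> 'k) \<Rightarrow> bool" where
  "normal_op K add sm ip S \<longleftrightarrow>
     bounded_op K add sm ip S \<and>
     (\<exists>Sa. bounded_op K add sm ip Sa \<and>
        (\<forall>x\<in>K. \<forall>y\<in>K. ip (S x) y = ip x (Sa y)) \<and>
        (\<forall>x\<in>K. S (Sa x) = Sa (S x)))"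

text \<open>T on D(mu) has a normal extension to the Hilbert space K: D(mu) is embedded
  in K by a linear inner-product preserving map J (i.e. K contains an isometric copy
  of D(mu)), and S is a normal operator on K with S restricted to J(D(mu)) equal to T.
  T is subnormal iff such K, J, S exist for some Hilbert space K.\<close>
definition has_normal_extension_in ::
  "'k set \<Rightarrow> ('k \<Rightarrow> 'k \<Rightarrow> 'k) \<Rightarrow> (complex \<Rightarrow> 'k \<Rightarrow> 'k) \<Rightarrow> ('k \<Rightarrow> 'k \<Rightarrow> complex)
   \<Rightarrow> complex measure \<Rightarrow> ((complex \<Rightarrow> complex) \<Rightarrow> (complex \<Rightarrow> complex)) \<Rightarrow> bool" where
  "has_normal_extension_in K add sm ip \<mu> T \<longleftrightarrow>
     (\<exists>J S. (\<forall>f\<in>Dspace \<mu>. J f \<in> K) \<and>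
        (\<forall>f\<in>Dspace \<mu>. \<forall>g\<in>Dspace \<mu>. J (\<lambda>z. f z + g z) = add (J f) (J g)) \<and>
        (\<forall>c. \<forall>f\<in>Dspace \<mu>. J (\<lambda>z. c * f z) = sm c (J f)) \<and>
        (\<forall>f\<in>Dspace \<mu>. \<forall>g\<in>Dspace \<mu>. ip (J f) (J g) = D_inner \<mu> f g) \<and>
        normal_op K add sm ip S \<and>
        (\<forall>f\<in>Dspace \<mu>. S (J f) = J (T f)))"

definition three_point_measure :: "complex \<Rightarrow> complex measure" where
  "three_point_measure \<zeta>1 =
     (let \<omega> = exp (2 * of_real pi * \<i> / 3)
      in point_measure {\<zeta>1, \<zeta>1 * \<omega>, \<zeta>1 * \<omega>\<^sup>2} (\<lambda>_. 1))"

end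

theory Submission
  imports Defs "HOL-Complex_Analysis.Complex_Analysis"
begin

text \<open>
  Write \<open>T\<close> for multiplication by \<open>z\<close> and \<open>T'\<close> for its Cauchy dual. The operator \<open>T\<^sup>*T - I\<close> has rank three:
  its form is the sum of \<open>f(p) * cnj (g(p))\<close> over the three mass points \<open>p\<close>. The cyclic symmetry
  splits \<open>D(\<mu>)\<close> into the three subspaces of functions \<open>z ^ j * \<phi>(z ^ 3)\<close>; on each of them \<open>T\<^sup>*T - I\<close> has rank
  one, and the element representing evaluation at the mass points is a multiple of \<open>z ^ j / (1 - r * z ^ 3)\<close>
  (for the mass point 1), where \<open>r\<^sup>2 - 11 * r + 1 = 0\<close>. Hence \<open>(T\<^sup>*T)\<^sup>-\<^sup>1\<close> is explicit, and with
  \<open>\<kappa> = 1 / (1 - r)\<close> the drops \<open>d n = \<parallel>T' ^ n 1\<parallel>\<^sup>2 - \<parallel>T' ^ (n + 1) 1\<parallel>\<^sup>2\<close> satisfy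
  \<open>d 1 = 3 / ((1 + 3 * \<kappa>) * (1 + 6 * \<kappa>))\<close>, \<open>d 2 = 3 / ((1 + 6 * \<kappa>) * (1 + 9 * \<kappa>))\<close> and
  \<open>d 3 = 3 / ((1 + 9 * \<kappa>)\<^sup>2 * (1 + 3 * \<kappa>))\<close>, so that \<open>d 2 ^ 2 > d 1 * d 3\<close>. For a restriction of a normal operator
  whose orbit is bounded in norm the drops are log-convex, which is a contradiction.
\<close>

section \<open>Orbits of normal operators\<close>

text \<open>For a normal \<open>S\<close> the squared norms along an orbit are moments of a spectral
  measure in the variable |lambda|^2. A bounded orbit confines that measure to |lambda| <= 1, so the
  drops are again moments of a positive measure. Test vectors s x + t S^*S x stand in for the
  spectral theorem: bounded log-convex sequences cannot rise at their first step, and applying this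
  to every such vector makes a quadratic form in s, t nonnegative.

  The obstacle is the inverse of T^*T, which is accessible only through \<open>A\<close> and
  \<open>B\<close>. The orbit consists of explicit power series converging beyond the disc, but
  \<open>A\<close> maps them to elements known only to lie in D(\<mu>). Hence radial limits and
  inner products with monomials are established for all of D(\<mu>), starting from integrability
  alone.

  Origin of the quadratic: pairing with \<open>z ^ j / (1 - r * z ^ 3)\<close> multiplies the Taylor
  contribution of class \<open>j\<close> by \<open>1 - 9 * r / (1 - r)\<^sup>2\<close>. The equation
  makes this factor zero, so that only the boundary values survive.\<close>

lemma log_convex_bounded_le:
  fixes c :: "nat \<Rightarrow> real"
  assumes nn: "\<And>n. 0 \<le> c n" and lc: "\<And>n. (c (Suc n))\<^sup>2 \<le> c n * c (Suc (Suc n))"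
    and bdd: "\<And>n. c n \<le> M"
  shows "c 1 \<le> c 0"
proof (rule ccontr)
  assume "\<not> c 1 \<le> c 0"
  then have gt: "c 0 < c 1" by simp
  then have c1: "c 1 > 0" using nn[of 0] by linarith
  have c0: "c 0 > 0" using lc[of 0] c1 nn[of 0] by (cases "c 0 = 0") auto
  define q where "q = c 1 / c 0"
  have q: "q > 1" using gt c0 by (simp add: q_def)
  \<comment> \<open>Log-convexity says that the quotients of consecutive terms do not decrease, so a
    first quotient \<open>q > 1\<close> forces geometric growth.\<close>
  have step: "c n > 0 \<and> q * c n \<le> c (Suc n)" for n
  proof (induction n)
    case 0
    then show ?case using c0 by (simp add: q_def)
  next
    case (Suc n)
    have pos: "c (Suc n) > 0" using Suc q by (smt (verit) mult_less_cancel_right1)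
    have "(q * c n) * c (Suc n) \<le> c (Suc n) * c (Suc n)"
      using Suc pos by (intro mult_right_mono) auto
    also have "\<dots> \<le> c n * c (Suc (Suc n))" using lc[of n] by (simp add: power2_eq_square)
    finally have "c n * (q * c (Suc n)) \<le> c n * c (Suc (Suc n))" by (simp add: algebra_simps)
    then show ?case using Suc pos by simp
  qed
  have "q ^ n * c 0 \<le> c n" for n
  proof (induction n)
    case (Suc n)
    have "q ^ Suc n * c 0 = q * (q ^ n * c 0)" by simp
    also have "\<dots> \<le> q * c n" using Suc q by simp
    also have "\<dots> \<le> c (Suc n)" using step by blast
    finally show ?case .
  qed simp
  then have "q ^ n \<le> M / c 0" for n
    using bdd[of n] c0 by (simp add: field_simps) (meson order_trans)
  then show False using q real_arch_pow[of q "M / c 0"] by (metis not_less)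
qed

lemma quadratic_nonneg_imp_le:
  fixes a b c :: real
  assumes "\<And>s t. 0 \<le> s\<^sup>2 * a + 2 * s * t * b + t\<^sup>2 * c"
  shows "b\<^sup>2 \<le> a * c"
proof -
  have a: "0 \<le> a" using assms[of 1 0] by simp
  have c: "0 \<le> c" using assms[of 0 1] by simp
  show ?thesis
  proof (cases "a = 0")
    case True
    \<comment> \<open>With \<open>a = 0\<close> the form is affine in \<open>s\<close>; the value
      \<open>s = - (c + 1)\<close> is negative enough to outweigh \<open>t\<^sup>2 * c\<close> at
      \<open>t = b\<close>.\<close>
    have "0 \<le> 2 * (- (c + 1)) * b * b + b\<^sup>2 * c" 
      using assms[of "- (c + 1)" b] True by (simp add: power2_eq_square algebra_simps)
    then have "b\<^sup>2 * (c + 2) \<le> 0" by (simp add: power2_eq_square algebra_simps)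
    then have "b\<^sup>2 \<le> 0" using c by (simp add: mult_le_0_iff)
    then show ?thesis using True by simp
  next
    case False
    have "0 \<le> (-b)\<^sup>2 * a + 2 * (-b) * a * b + a\<^sup>2 * c" by (rule assms)
    then have "a * b\<^sup>2 \<le> a * (a * c)" by (simp add: power2_eq_square algebra_simps)
    then show ?thesis using a False by simp
  qed
qed

locale hilbert_normal =
  fixes K :: "'k set" and add sm zero ip S Sa
  assumes hilb: "chilbert K add sm zero ip"
    and S_bdd: "bounded_op K add sm ip S" and Sa_bdd: "bounded_op K add sm ip Sa"
    and adj: "\<And>x y. x \<in> K \<Longrightarrow> y \<in> K \<Longrightarrow> ip (S x) y = ip x (Sa y)"
    and comm: "\<And>x. x \<in> K \<Longrightarrow> S (Sa x) = Sa (S x)"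
begin

definition sq :: "'k \<Rightarrow> real" where "sq x = Re (ip x x)"

lemma closed [simp]:
  "x \<in> K \<Longrightarrow> y \<in> K \<Longrightarrow> add x y \<in> K" "x \<in> K \<Longrightarrow> sm c x \<in> K"
  "x \<in> K \<Longrightarrow> S x \<in> K" "x \<in> K \<Longrightarrow> Sa x \<in> K"
proof -
  have "\<forall>x\<in>K. \<forall>y\<in>K. add x y \<in> K" "\<forall>c. \<forall>x\<in>K. sm c x \<in> K"
    using hilb by (simp_all add: chilbert_def)
  then show "x \<in> K \<Longrightarrow> y \<in> K \<Longrightarrow> add x y \<in> K" "x \<in> K \<Longrightarrow> sm c x \<in> K"
    by blast+
qed (use S_bdd Sa_bdd in \<open>simp_all add: bounded_op_def\<close>)

lemma S_linear [simp]:
  "x \<in> K \<Longrightarrow> y \<in> K \<Longrightarrow> S (add x y) = add (S x) (S y)" "x \<in> K \<Longrightarrow> S (sm c x) = sm c (S x)"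
  "x \<in> K \<Longrightarrow> y \<in> K \<Longrightarrow> Sa (add x y) = add (Sa x) (Sa y)" "x \<in> K \<Longrightarrow> Sa (sm c x) = sm c (Sa x)"
  using S_bdd Sa_bdd unfolding bounded_op_def by blast+

lemma ip_left [simp]:
  "x \<in> K \<Longrightarrow> y \<in> K \<Longrightarrow> w \<in> K \<Longrightarrow> ip (add x y) w = ip x w + ip y w"
  "x \<in> K \<Longrightarrow> w \<in> K \<Longrightarrow> ip (sm c x) w = c * ip x w"
  using hilb unfolding chilbert_def by blast+

lemma ip_sym: "x \<in> K \<Longrightarrow> y \<in> K \<Longrightarrow> ip y x = cnj (ip x y)"
  using hilb unfolding chilbert_def by blast

lemma ip_right [simp]:
  assumes "x \<in> K" "y \<in> K" "w \<in> K"
  shows "ip w (add x y) = ip w x + ip w y" "ip w (sm c x) = cnj c * ip w x"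
  using assms ip_sym[of "add x y" w] ip_sym[of x w] ip_sym[of y w] ip_sym[of "sm c x" w] by auto

lemma sq_nonneg: "x \<in> K \<Longrightarrow> 0 \<le> sq x"
  using hilb unfolding chilbert_def sq_def by blast

lemma sq_Sa: "x \<in> K \<Longrightarrow> sq (Sa x) = sq (S x)"
  using adj[of "Sa x" x] adj[of x "S x"] comm[of x] ip_sym[of x "Sa (S x)"] complex_cnj_cancel_iff by (simp add: sq_def) (metis cnj.sel(1))

text \<open>By normality \<open>\<parallel>S\<^sup>*S x\<parallel> = \<parallel>S S x\<parallel>\<close>, so no inner products survive in the expansion.\<close>

lemma sq_comb:
  assumes x: "x \<in> K"
  shows "sq (add (sm (of_real s) x) (sm (of_real t) (Sa (S x)))) =
    s\<^sup>2 * sq x + 2 * s * t * sq (S x) + t\<^sup>2 * sq (S (S x))"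
proof -
  have 1: "ip x (Sa (S x)) = ip (S x) (S x)" using adj[of x "S x"] x by simp
  have 2: "ip (Sa (S x)) x = cnj (ip (S x) (S x))" using 1 ip_sym[of x "Sa (S x)"] x by simp
  have "Re (ip (Sa (S x)) (Sa (S x))) = Re (ip (S (S x)) (S (S x)))"
    using sq_Sa[of "S x"] x by (simp add: sq_def)
  then show ?thesis
    using x by (simp add: sq_def 1 2 algebra_simps power2_eq_square)
qed

lemma iter_closed [simp]: "x \<in> K \<Longrightarrow> (S ^^ n) x \<in> K"
  by (induction n) auto

text \<open>\<open>S\<close> commutes with S^*S by normality, so \<open>sq_comb\<close> applies at
  every point of the orbit of the combined vector.\<close>

lemma iter_comb:
  assumes x: "x \<in> K"
  shows "(S ^^ n) (add (sm s x) (sm t (Sa (S x)))) = 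
    add (sm s ((S ^^ n) x)) (sm t (Sa (S ((S ^^ n) x))))"
proof (induction n)
  case (Suc n)
  have "S (Sa (S ((S ^^ n) x))) = Sa (S (S ((S ^^ n) x)))" using x by (intro comm) simp
  then show ?case using x by (simp add: Suc)
qed simp

text \<open>The quadratic form with these three coefficients is a squared norm, by
  \<open>sq_comb\<close> at \<open>(S ^^ n) x\<close>.\<close>

lemma sq_iter_log_convex:
  assumes "x \<in> K"
  shows "(sq ((S ^^ Suc n) x))\<^sup>2 \<le> sq ((S ^^ n) x) * sq ((S ^^ Suc (Suc n)) x)"
proof (rule quadratic_nonneg_imp_le)
  fix s t
  show "0 \<le> s\<^sup>2 * sq ((S ^^ n) x) + 2 * s * t * sq ((S ^^ Suc n) x) + t\<^sup>2 * sq ((S ^^ Suc (Suc n)) x)"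
    using sq_comb[of "(S ^^ n) x" s t] assms
      sq_nonneg[of "add (sm (of_real s) ((S ^^ n) x)) (sm (of_real t) (Sa (S ((S ^^ n) x))))"] by simp
qed

text \<open>With y = s u + t S^*S u and u the \<open>m\<close>-th iterate of \<open>x\<close>, the
  form in the three drops is \<open>sq y - sq (S y)\<close>. The orbit of y is bounded as well, so
  its log-convex norms cannot grow at the first step and the form is nonnegative.\<close>

theorem sq_iter_drop_log_convex:
  assumes x: "x \<in> K" and bdd: "\<And>n. sq ((S ^^ n) x) \<le> M"
  defines "d \<equiv> \<lambda>n. sq ((S ^^ n) x) - sq ((S ^^ Suc n) x)"
  shows "(d (Suc m))\<^sup>2 \<le> d m * d (Suc (Suc m))"
proof (rule quadratic_nonneg_imp_le)
  fix s t :: real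
  define u where "u = (S ^^ m) x"
  have u: "u \<in> K" using x by (simp add: u_def)
  have um: "(S ^^ n) u = (S ^^ (n + m)) x" for n by (simp add: u_def funpow_add)
  define y where "y = add (sm (of_real s) u) (sm (of_real t) (Sa (S u)))"
  have y: "y \<in> K" using u by (simp add: y_def)
  have c: "sq ((S ^^ n) y) = s\<^sup>2 * sq ((S ^^ (n+m)) x) + 2 * s * t * sq ((S ^^ Suc (n+m)) x)
      + t\<^sup>2 * sq ((S ^^ Suc (Suc (n+m))) x)" for n
    unfolding y_def iter_comb[OF u] um using x by (subst sq_comb) simp_all
  have M: "\<bar>sq ((S ^^ n) x)\<bar> \<le> M" for n using bdd[of n] sq_nonneg[of "(S ^^ n) x"] x by simp
  have "sq ((S ^^ 1) y) \<le> sq ((S ^^ 0) y)"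
  proof (rule log_convex_bounded_le[where c = "\<lambda>n. sq ((S ^^ n) y)"])
    fix n
    have t: "a * b \<le> \<bar>a\<bar> * M" if "\<bar>b\<bar> \<le> M" for a b :: real
      using mult_left_mono[OF that abs_ge_zero[of a]] abs_ge_self[of "a * b"] by (simp add: abs_mult)
    show "sq ((S ^^ n) y) \<le> \<bar>s\<^sup>2\<bar> * M + \<bar>2 * s * t\<bar> * M + \<bar>t\<^sup>2\<bar> * M"
      unfolding c by (intro add_mono t M)
    show "0 \<le> sq ((S ^^ n) y)" using y by (intro sq_nonneg) simp
    show "(sq ((S ^^ Suc n) y))\<^sup>2 \<le> sq ((S ^^ n) y) * sq ((S ^^ Suc (Suc n)) y)"
      using y by (rule sq_iter_log_convex)
  qed
  then show "0 \<le> s\<^sup>2 * d m + 2 * s * t * d (Suc m) + t\<^sup>2 * d (Suc (Suc m))"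
    unfolding c d_def by (simp add: algebra_simps)
qed

end

section \<open>Moments of the disc\<close>

lemma nn_integral_lborel_translate:
  fixes f :: "'a::euclidean_space \<Rightarrow> ennreal"
  assumes [measurable]: "f \<in> borel_measurable borel"
  shows "(\<integral>\<^sup>+x. f (c + x) \<partial>lborel) = (\<integral>\<^sup>+x. f x \<partial>lborel)"
proof -
  have "(\<integral>\<^sup>+x. f x \<partial>lborel) = (\<integral>\<^sup>+x. f x \<partial>distr lborel borel ((+) c))"
    by (simp add: lborel_distr_plus)
  also have "\<dots> = (\<integral>\<^sup>+x. f (c + x) \<partial>lborel)"
    by (subst nn_integral_distr) auto
  finally show ?thesis by simp
qed

text \<open>Uniqueness of Haar measure by convolution with the unit ball, whose volume is invariant under
  rotations and reflections.\<close>

lemma nn_integral_lborel_rotate: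
  fixes f :: "complex \<Rightarrow> ennreal"
  assumes [measurable]: "f \<in> borel_measurable borel" and u: "cmod u = 1"
  shows "(\<integral>\<^sup>+x. f (u * x) \<partial>lborel) = (\<integral>\<^sup>+x. f x \<partial>lborel)"
proof -
  define g :: "complex \<Rightarrow> ennreal" where "g = indicator (ball 0 1)"
  have [measurable]: "g \<in> borel_measurable borel" unfolding g_def by (intro borel_measurable_indicator) auto
  define c where "c = emeasure lborel (ball (0::complex) 1)"
  have c0: "c \<noteq> 0" "c \<noteq> \<infinity>"
    by (auto simp: c_def emeasure_ball ennreal_eq_0_iff unit_ball_vol_numeral not_le)
  have gc: "(\<integral>\<^sup>+y. g y \<partial>lborel) = c" by (simp add: g_def c_def)
  have u0: "u \<noteq> 0" using u by auto
  have inner: "(\<integral>\<^sup>+x. g (y - u * x) \<partial>lborel) = c" for y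
  proof -
    have "g (y - u * x) = indicator (ball (y / u) 1) x" for x
    proof -
      have "cmod (y - u * x) = cmod (u * (y / u - x))"
        using u0 by (simp add: algebra_simps)
      also have "\<dots> = cmod (y / u - x)" by (simp add: norm_mult u)
      finally show ?thesis by (simp add: g_def indicator_def dist_norm norm_minus_commute[of "u * x" y])
    qed
    then show ?thesis by (simp add: c_def emeasure_ball)
  qed
  have "(\<integral>\<^sup>+x. f (u * x) \<partial>lborel) * c = (\<integral>\<^sup>+x. f (u * x) \<partial>lborel) * (\<integral>\<^sup>+y. g y \<partial>lborel)"
    by (simp add: gc)
  also have "\<dots> = (\<integral>\<^sup>+y. (\<integral>\<^sup>+x. f (u * x) * g y \<partial>lborel) \<partial>lborel)"
    by (simp add: nn_integral_cmult nn_integral_multc)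
  \<comment> \<open>Shifting \<open>x\<close> by \<open>y / u\<close> turns \<open>u * x\<close>
    into \<open>u * x + y\<close>. After an exchange of integrals and a shift in \<open>y\<close>,
    the rotation acts only on the ball, whose volume is \<open>c\<close> by \<open>inner\<close>;
    \<open>c\<close> then cancels.\<close>
  also have "\<dots> = (\<integral>\<^sup>+y. (\<integral>\<^sup>+x. f (u * (y / u + x)) * g y \<partial>lborel) \<partial>lborel)"
  proof (rule nn_integral_cong)
    fix y
    show "(\<integral>\<^sup>+x. f (u * x) * g y \<partial>lborel) = (\<integral>\<^sup>+x. f (u * (y / u + x)) * g y \<partial>lborel)"
      using nn_integral_lborel_translate[of "\<lambda>x. f (u * x) * g y" "y / u"] by simp
  qed
  also have "\<dots> = (\<integral>\<^sup>+y. (\<integral>\<^sup>+x. f (u * x + y) * g y \<partial>lborel) \<partial>lborel)"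
    using u0 by (simp add: algebra_simps)
  also have "\<dots> = (\<integral>\<^sup>+x. (\<integral>\<^sup>+y. f (u * x + y) * g y \<partial>lborel) \<partial>lborel)"
    by (rule lborel_pair.Fubini') measurable
  also have "\<dots> = (\<integral>\<^sup>+x. (\<integral>\<^sup>+y. f y * g (y - u * x) \<partial>lborel) \<partial>lborel)"
  proof (rule nn_integral_cong)
    fix x
    show "(\<integral>\<^sup>+y. f (u * x + y) * g y \<partial>lborel) = (\<integral>\<^sup>+y. f y * g (y - u * x) \<partial>lborel)"
      using nn_integral_lborel_translate[of "\<lambda>y. f y * g (y - u * x)" "u * x"] by simp
  qed
  also have "\<dots> = (\<integral>\<^sup>+y. (\<integral>\<^sup>+x. f y * g (y - u * x) \<partial>lborel) \<partial>lborel)"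
    by (rule lborel_pair.Fubini') measurable
  also have "\<dots> = (\<integral>\<^sup>+y. f y \<partial>lborel) * c"
    by (simp add: nn_integral_cmult nn_integral_multc inner)
  finally show ?thesis
    using c0 ennreal_mult_cancel_left[of c] by (auto simp: mult.commute)
qed

lemma lborel_distr_rotate:
  assumes u: "cmod u = 1"
  shows "distr lborel borel ((*) u) = (lborel :: complex measure)"
proof (rule measure_eqI)
  fix A :: "complex set" assume "A \<in> sets (distr lborel borel ((*) u))"
  then have [measurable]: "A \<in> sets borel" by simp
  have "emeasure (distr lborel borel ((*) u)) A = (\<integral>\<^sup>+x. indicator A x \<partial>distr lborel borel ((*) u))"
    by simp
  also have "\<dots> = (\<integral>\<^sup>+x. indicator A (u * x) \<partial>lborel)"
    by (subst nn_integral_distr) auto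
  also have "\<dots> = emeasure lborel A"
    by (subst nn_integral_lborel_rotate[OF _ u]) auto
  finally show "emeasure (distr lborel borel ((*) u)) A = emeasure lborel A" .
qed auto

lemma borel_measurable_cnj [measurable (raw)]:
  "f \<in> borel_measurable M \<Longrightarrow> (\<lambda>x. cnj (f x)) \<in> borel_measurable M"
  by (rule measurable_compose[OF _ borel_measurable_continuous_onI]) (auto intro: continuous_intros)

text \<open>Rotation by the angle \<open>pi / (p - q)\<close> preserves the disc and the measure but
  changes the sign of the integrand.\<close>

lemma disc_moment_offdiag:
  assumes "p \<noteq> q"
  shows "(LINT z : ball 0 R | lborel. z ^ p * cnj z ^ q) = 0"
proof -
  define f where "f = (\<lambda>z::complex. indicat_real (ball 0 R) z *\<^sub>R (z ^ p * cnj z ^ q))"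
  have f[measurable]: "f \<in> borel_measurable borel" unfolding f_def
    by (intro borel_measurable_scaleR borel_measurable_indicator borel_measurable_continuous_onI continuous_intros) auto
  define u where "u = cis (pi / (real p - real q))"
  have u: "cmod u = 1" by (simp add: u_def)
  have uu: "u ^ p * cnj u ^ q = - 1"
  proof -
    have "u ^ p * cnj u ^ q = cis ((real p - real q) * (pi / (real p - real q)))"
      by (simp add: u_def cis_cnj Complex.DeMoivre cis_mult left_diff_distrib diff_divide_distrib)
    also have "\<dots> = -1" using assms by (simp add: cis_pi)
    finally show ?thesis .
  qed
  have fu: "f (u * z) = - f z" for z
  proof -
    have "f (u * z) = indicat_real (ball 0 R) z *\<^sub>R ((u ^ p * cnj u ^ q) * (z ^ p * cnj z ^ q))"
      using u by (simp add: f_def norm_mult power_mult_distrib indicator_def algebra_simps)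
    then show ?thesis unfolding uu by (simp add: f_def)
  qed
  have "integral\<^sup>L lborel f = integral\<^sup>L (distr lborel borel ((*) u)) f"
    by (simp add: lborel_distr_rotate[OF u])
  also have "\<dots> = integral\<^sup>L lborel (\<lambda>z. f (u * z))"
    by (subst integral_distr) auto
  also have "\<dots> = - integral\<^sup>L lborel f" by (simp add: fu)
  finally show ?thesis
    unfolding set_lebesgue_integral_def f_def[symmetric] by (simp add: eq_neg_iff_add_eq_0)
qed


lemma measure_disc: "0 \<le> R \<Longrightarrow> measure lborel (ball (0::complex) R) = pi * R\<^sup>2"
  using content_ball[of R "0::complex"] by (simp add: unit_ball_vol_numeral)

lemma power_norm_disc_integrable:
  "set_integrable lborel (ball (0::complex) R) (\<lambda>z. cmod z ^ p)"
  by (rule set_integrable_subset[of _ "cball 0 R"])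
     (use borel_integrable_compact[of "cball (0::complex) R" "\<lambda>z. cmod z ^ p"]
      in \<open>auto simp: set_integrable_def intro!: continuous_intros\<close>)

lemma disc_moment_scale:
  assumes "R > 0"
  shows "(LINT z : ball (0::complex) R | lborel. cmod z ^ (2*p)) =
    R ^ (2*p+2) * (LINT z : ball (0::complex) 1 | lborel. cmod z ^ (2*p))"
proof -
  define f where "f = (\<lambda>z::complex. indicat_real (ball 0 R) z *\<^sub>R cmod z ^ (2*p))"
  have f[measurable]: "f \<in> borel_measurable borel" unfolding f_def
    by (intro borel_measurable_scaleR borel_measurable_indicator borel_measurable_continuous_onI continuous_intros) auto
  have "integral\<^sup>L lborel f = integral\<^sup>L (density (distr lborel borel (\<lambda>x. 0 + R *\<^sub>R x)) (\<lambda>_. \<bar>R\<bar>^DIM(complex))) f"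
    using lborel_affine[of R "0::complex"] assms by simp
  also have "\<dots> = integral\<^sup>L lborel (\<lambda>z. R\<^sup>2 *\<^sub>R f (R *\<^sub>R z))"
    using assms by (subst integral_density) (auto simp: integral_distr)
  also have "\<dots> = integral\<^sup>L lborel (\<lambda>z. R ^ (2*p+2) * (indicat_real (ball 0 1) z *\<^sub>R cmod z ^ (2*p)))"
    using assms by (intro Bochner_Integration.integral_cong)
      (auto simp: f_def indicator_def power_mult_distrib power_add power2_eq_square)
  finally show ?thesis
    unfolding set_lebesgue_integral_def f_def by simp
qed

text \<open>Scaling makes the moment of a disc of radius \<open>R\<close> proportional to \<open>R ^ (2 * p + 2)\<close>; the constant comes from
  estimating the integral over a thin annulus at the unit circle.\<close>

lemma disc_moment_diag_unit:
  "(LINT z : ball (0::complex) 1 | lborel. cmod z ^ (2*p)) = pi / (p + 1)"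
proof -
  define J where "J = (LINT z : ball (0::complex) 1 | lborel. cmod z ^ (2*p))"
  define S where "S = (\<lambda>R::real. \<Sum>i<Suc p. (R\<^sup>2) ^ i)"
  have bounds: "R ^ (2*p) * pi \<le> S R * J \<and> S R * J \<le> pi" if R: "R \<in> {0<..<1}" for R
  proof -
    have R': "0 < R" "R < 1" using R by auto
    let ?A = "ball (0::complex) 1 - ball 0 R"
    have U: "ball (0::complex) 1 = ?A \<union> ball 0 R" using R' by auto
    have fin: "emeasure lborel ?A < \<infinity>"
      by (rule le_less_trans[OF emeasure_mono[of _ "ball 0 1"]]) (auto simp: emeasure_ball)
    have iA: "set_integrable lborel ?A (\<lambda>z. cmod z ^ (2*p))"
      by (rule set_integrable_subset[OF power_norm_disc_integrable[of 1]]) auto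
    have ic: "set_integrable lborel ?A (\<lambda>z. c)" for c :: real
      using fin by (simp add: set_integrable_def)
    have "J = (LINT z : ?A | lborel. cmod z ^ (2*p)) + R ^ (2*p+2) * J"
      unfolding J_def disc_moment_scale[OF R'(1), symmetric]
      by (subst U, subst set_integral_Un) (auto simp: iA power_norm_disc_integrable)
    then have J: "(LINT z : ?A | lborel. cmod z ^ (2*p)) = (1 - (R\<^sup>2) ^ Suc p) * J"
      by (simp add: algebra_simps power_mult power_add power2_eq_square)
    \<comment> \<open>The area of the annulus carries the same factor \<open>1 - R\<^sup>2\<close>.
      Once it is cancelled, the limit at \<open>R = 1\<close> is informative, with
      \<open>S 1 = p + 1\<close>.\<close>
    have S: "1 - (R\<^sup>2) ^ Suc p = (1 - R\<^sup>2) * S R"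
      unfolding S_def by (simp only: one_diff_power_eq)
    have mA: "measure lborel ?A = pi * (1 - R\<^sup>2)"
      using R' by (subst measure_Diff) (auto simp: measure_disc algebra_simps emeasure_ball)
    have const: "(LINT z : ?A | lborel. c) = c * (pi * (1 - R\<^sup>2))" for c :: real
      using fin by (simp add: set_lebesgue_integral_def mA)
    have "(LINT z : ?A | lborel. R ^ (2*p)) \<le> (LINT z : ?A | lborel. cmod z ^ (2*p))"
      using R' by (intro set_integral_mono ic iA power_mono) (auto simp: dist_norm)
    moreover have "(LINT z : ?A | lborel. cmod z ^ (2*p)) \<le> (LINT z : ?A | lborel. 1)"
      by (intro set_integral_mono ic iA power_le_one) (auto simp: dist_norm)
    ultimately have "(1 - R\<^sup>2) * (R ^ (2*p) * pi) \<le> (1 - R\<^sup>2) * (S R * J)"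
      "(1 - R\<^sup>2) * (S R * J) \<le> (1 - R\<^sup>2) * pi"
      unfolding const J S by (simp_all add: algebra_simps)
    moreover have "1 - R\<^sup>2 > 0" using R' by (simp add: power_less_one_iff)
    ultimately show ?thesis by simp
  qed
  have ev: "eventually (\<lambda>R. R \<in> {0<..<1}) (at_left (1::real))"
    using eventually_at_left_real[of 0 1] by simp
  have "((\<lambda>R. S R * J) \<longlongrightarrow> S 1 * J) (at_left 1)"
    unfolding S_def by (intro tendsto_intros)
  moreover have "((\<lambda>R. S R * J) \<longlongrightarrow> pi) (at_left 1)"
  proof (rule tendsto_sandwich[where f="\<lambda>R. R ^ (2*p) * pi" and h="\<lambda>_. pi"])
    have "((\<lambda>R::real. R ^ (2*p) * pi) \<longlongrightarrow> 1 ^ (2*p) * pi) (at_left 1)"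
      by (intro tendsto_intros)
    then show "((\<lambda>R::real. R ^ (2*p) * pi) \<longlongrightarrow> pi) (at_left 1)" by simp
  qed (use bounds in \<open>auto intro: eventually_mono[OF ev]\<close>)
  ultimately have "S 1 * J = pi"
    using tendsto_unique trivial_limit_at_left_real by blast
  then show ?thesis by (simp add: S_def J_def field_simps)
qed

lemma disc_moment:
  assumes "R > 0"
  shows "(LINT z : ball 0 R | lborel. z ^ p * cnj z ^ q) =
    (if p = q then complex_of_real (pi * R ^ (2*p+2) / (p + 1)) else 0)"
proof (cases "p = q")
  case True
  have "z ^ p * cnj z ^ p = complex_of_real (cmod z ^ (2*p))" for z :: complex
    by (metis complex_norm_square of_real_power power_mult power_mult_distrib)
  then show ?thesis
    using True disc_moment_scale[OF assms, of p]
    by (simp add: set_integral_complex_of_real disc_moment_diag_unit del: of_real_power flip: of_real_power)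
qed (simp add: disc_moment_offdiag)

section \<open>Poisson-weighted integrals and boundary values\<close>

text \<open>Only the weight has to be integrable, while the series is bounded by constants
  independent of the point. This covers the full disc too, where the weight \<open>deriv g\<close>
  times the Poisson integral may be unbounded.\<close>

lemma set_integral_suminf_dominated:
  fixes w :: "'a \<Rightarrow> complex"
  assumes w: "set_integrable M S w" and S[measurable]: "S \<in> sets M"
    and [measurable]: "\<And>q. \<phi> q \<in> borel_measurable M"
    and le: "\<And>q z. z \<in> S \<Longrightarrow> cmod (\<phi> q z) \<le> c q" and c: "summable c"
  shows "(\<lambda>q. LINT z:S|M. w z * \<phi> q z) sums (LINT z:S|M. w z * (\<Sum>q. \<phi> q z))"
proof -
  define f where "f = (\<lambda>q z. indicat_real S z *\<^sub>R (w z * \<phi> q z))"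
  have wi: "integrable M (\<lambda>z. indicat_real S z *\<^sub>R w z)"
    using w by (simp add: set_integrable_def)
  have f_eq: "f q z = (indicat_real S z *\<^sub>R w z) * \<phi> q z" for q z by (simp add: f_def)
  have f_le: "norm (f q z) \<le> c q * norm (indicat_real S z *\<^sub>R w z)" for q z
    using mult_left_mono[OF le[of z q], of "cmod (w z)"]
    by (auto simp: f_def indicator_def norm_mult mult.commute)
  have ci: "integrable M (\<lambda>z. c q * norm (indicat_real S z *\<^sub>R w z))" for q
    by (intro integrable_mult_right integrable_norm wi)
  have fi: "integrable M (f q)" for q
  proof (rule Bochner_Integration.integrable_bound[OF ci[of q]])
    show "f q \<in> borel_measurable M"
      unfolding f_eq[abs_def] using borel_measurable_integrable[OF wi] by measurable
    show "AE z in M. norm (f q z) \<le> norm (c q * norm (indicat_real S z *\<^sub>R w z))"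
      by (intro AE_I2) (simp only: real_norm_def order_trans[OF f_le abs_ge_self])
  qed
  have "(\<lambda>q. integral\<^sup>L M (f q)) sums (\<integral>z. (\<Sum>q. f q z) \<partial>M)"
  proof (rule sums_integral[OF fi])
    show "AE z in M. summable (\<lambda>q. norm (f q z))"
    proof (rule AE_I2)
      fix z
      show "summable (\<lambda>q. norm (f q z))"
        by (rule summable_comparison_test'[OF summable_mult2[OF c, of "norm (indicat_real S z *\<^sub>R w z)"], of 0])
           (simp add: f_le del: norm_scaleR)
    qed
    show "summable (\<lambda>q. \<integral>z. norm (f q z) \<partial>M)"
    proof (rule summable_comparison_test'[OF summable_mult2[OF c, of "\<integral>z. norm (indicat_real S z *\<^sub>R w z) \<partial>M"], of 0])
      fix q
      have "(\<integral>z. norm (f q z) \<partial>M) \<le> (\<integral>z. c q * norm (indicat_real S z *\<^sub>R w z) \<partial>M)"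
        using fi ci by (intro integral_mono f_le) auto
      then show "norm (\<integral>z. norm (f q z) \<partial>M) \<le> c q * (\<integral>z. norm (indicat_real S z *\<^sub>R w z) \<partial>M)"
        using wi by (simp del: norm_scaleR)
    qed
  qed
  moreover have "(\<Sum>q. f q z) = indicat_real S z *\<^sub>R (w z * (\<Sum>q. \<phi> q z))" for z
  proof (cases "z \<in> S")
    case True
    have "summable (\<lambda>q. \<phi> q z)"
      by (rule summable_comparison_test'[OF c, of 0]) (use le[OF True] in auto)
    then show ?thesis using True by (simp add: f_def suminf_mult)
  qed (simp add: f_def)
  ultimately show ?thesis
    unfolding set_lebesgue_integral_def f_def by simp
qed

lemma set_integrable_disc_continuous:
  fixes F :: "complex \<Rightarrow> complex"
  assumes F: "continuous_on (ball 0 1) F" and R: "R < 1"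
  shows "set_integrable lborel (ball 0 R) F"
proof (rule set_integrable_subset[of _ "cball 0 R"])
  show "set_integrable lborel (cball 0 R) F"
    using borel_integrable_compact[of "cball (0::complex) R" F] continuous_on_subset[OF F, of "cball 0 R"] R
    by (auto simp: set_integrable_def subset_eq)
qed auto

text \<open>Termwise integration on a smaller disc; orthogonality of the monomials leaves one
  term.\<close>

lemma disc_integral_mult_cnj_power:
  assumes F: "\<And>z. cmod z < 1 \<Longrightarrow> (\<lambda>p. a p * z ^ p) sums F z" and R: "0 < R" "R < 1"
  shows "(LINT z : ball 0 R | lborel. F z * cnj z ^ q) = a q * complex_of_real (pi * R ^ (2*q+2) / (q+1))"
proof -
  let ?B = "ball (0::complex) R"
  \<comment> \<open>Convergence at the midpoint of \<open>R\<close> and 1 gives absolute convergence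
    at \<open>R\<close>.\<close>
  have cp: "summable (\<lambda>p. cmod (a p * of_real R ^ p))"
    using R by (intro powser_insidea[OF sums_summable[OF F[of "of_real ((R+1)/2)"]]])
      (simp_all del: of_real_add of_real_divide)
  have "(\<lambda>p. LINT z:?B|lborel. cnj z ^ q * (a p * z ^ p)) sums
      (LINT z:?B|lborel. cnj z ^ q * (\<Sum>p. a p * z ^ p))"
  proof (rule set_integral_suminf_dominated[OF _ _ _ _ cp])
    show "set_integrable lborel ?B (\<lambda>z. cnj z ^ q)"
      using R by (intro set_integrable_disc_continuous continuous_intros)
    show "cmod (a p * z ^ p) \<le> cmod (a p * of_real R ^ p)" if "z \<in> ?B" for p z
      using that R by (auto simp: norm_mult norm_power intro!: mult_left_mono power_mono)
  qed (auto intro!: borel_measurable_continuous_onI continuous_intros)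
  moreover have "(LINT z:?B|lborel. cnj z ^ q * (\<Sum>p. a p * z ^ p)) = (LINT z : ?B | lborel. F z * cnj z ^ q)"
    using R sums_unique[OF F] by (intro set_lebesgue_integral_cong) (auto simp: mult.commute)
  moreover have "(LINT z:?B|lborel. cnj z ^ q * (a p * z ^ p)) =
      (if p = q then a q * complex_of_real (pi * R ^ (2*q+2) / (q+1)) else 0)" for p
  proof -
    have "(LINT z:?B|lborel. cnj z ^ q * (a p * z ^ p)) = (LINT z:?B|lborel. a p * (z ^ p * cnj z ^ q))"
      by (simp add: mult_ac)
    also have "\<dots> = a p * (LINT z:?B|lborel. z ^ p * cnj z ^ q)" by simp
    finally show ?thesis using disc_moment[OF R(1), of p q] by simp
  qed
  ultimately show ?thesis
    using sums_unique2[OF _ sums_single[of q "\<lambda>_. a q * complex_of_real (pi * R ^ (2*q+2) / (q+1))"]]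
    by (simp add: eq_commute)
qed

lemma sums_power_continuous_on_disc:
  assumes F: "\<And>z::complex. cmod z < 1 \<Longrightarrow> (\<lambda>p. a p * z ^ p) sums F z"
  shows "continuous_on (ball 0 1) F"
proof (rule holomorphic_on_imp_continuous_on)
  show "F holomorphic_on ball 0 1"
    using F by (intro power_series_holomorphic[of 0 1 a]) auto
qed

text \<open>Only \<open>G\<close> is expanded; each term is already evaluated by
  \<open>disc_integral_mult_cnj_power\<close>, so no double series occurs.\<close>

lemma disc_integral_pairing:
  assumes F: "\<And>z. cmod z < 1 \<Longrightarrow> (\<lambda>p. a p * z ^ p) sums F z"
    and G: "\<And>z. cmod z < 1 \<Longrightarrow> (\<lambda>p. b p * z ^ p) sums G z" and R: "0 < R" "R < 1"
  shows "(\<lambda>q. a q * cnj (b q) * complex_of_real (pi * R ^ (2*q+2) / (q+1))) sums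
    (LINT z : ball 0 R | lborel. F z * cnj (G z))"
proof -
  let ?B = "ball (0::complex) R"
  have cp: "summable (\<lambda>p. cmod (b p * of_real R ^ p))"
    using R by (intro powser_insidea[OF sums_summable[OF G[of "of_real ((R+1)/2)"]]])
      (simp_all del: of_real_add of_real_divide)
  have "(\<lambda>p. LINT z:?B|lborel. F z * cnj (b p * z ^ p)) sums
      (LINT z:?B|lborel. F z * (\<Sum>p. cnj (b p * z ^ p)))"
  proof (rule set_integral_suminf_dominated[OF _ _ _ _ cp])
    show "set_integrable lborel ?B F"
      using R by (intro set_integrable_disc_continuous sums_power_continuous_on_disc[OF F])
    show "cmod (cnj (b p * z ^ p)) \<le> cmod (b p * of_real R ^ p)" if "z \<in> ?B" for p z
      using that R by (auto simp: norm_mult norm_power intro!: mult_left_mono power_mono)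
  qed (auto intro!: borel_measurable_continuous_onI continuous_intros)
  moreover have "(LINT z:?B|lborel. F z * (\<Sum>p. cnj (b p * z ^ p))) = (LINT z : ?B | lborel. F z * cnj (G z))"
    using R by (intro set_lebesgue_integral_cong)
      (auto simp del: complex_cnj_mult complex_cnj_power simp: sums_unique[OF sums_cnj[THEN iffD2, OF G], symmetric])
  moreover have "(LINT z:?B|lborel. F z * cnj (b p * z ^ p)) = a p * cnj (b p) * complex_of_real (pi * R ^ (2*p+2) / (p+1))" for p
  proof -
    have "(LINT z:?B|lborel. F z * cnj (b p * z ^ p)) = (LINT z:?B|lborel. cnj (b p) * (F z * cnj z ^ p))"
      by (simp add: mult_ac)
    also have "\<dots> = cnj (b p) * (LINT z:?B|lborel. F z * cnj z ^ p)" by simp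
    also have "(LINT z:?B|lborel. F z * cnj z ^ p) = a p * complex_of_real (pi * R ^ (2*p+2) / (p+1))"
      by (rule disc_integral_mult_cnj_power[OF F R])
    finally show ?thesis by (simp only: mult_ac)
  qed
  ultimately show ?thesis by simp
qed


section \<open>Herglotz expansion of the Poisson kernel and integrals over smaller discs\<close>

definition poisson_kernel :: "complex \<Rightarrow> complex \<Rightarrow> real" where
  "poisson_kernel \<zeta> z = (1 - (cmod z)\<^sup>2) / (cmod (z - \<zeta>))\<^sup>2"

lemma poisson_kernel_nonneg: "cmod z < 1 \<Longrightarrow> 0 \<le> poisson_kernel \<zeta> z"
  by (auto simp: poisson_kernel_def power_le_one_iff abs_square_le_1)

lemma continuous_on_poisson_kernel:
  "cmod \<zeta> = 1 \<Longrightarrow> continuous_on (ball 0 1) (poisson_kernel \<zeta>)"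
  unfolding poisson_kernel_def by (intro continuous_intros) auto

definition herglotz_coeff :: "complex \<Rightarrow> nat \<Rightarrow> complex" where
  "herglotz_coeff \<zeta> k = (if k = 0 then 1 else 2 * cnj \<zeta> ^ k)"

definition herglotz :: "complex \<Rightarrow> complex \<Rightarrow> complex" where
  "herglotz \<zeta> z = (\<zeta> + z) / (\<zeta> - z)"

lemma herglotz_sums:
  assumes \<zeta>: "cmod \<zeta> = 1" and z: "cmod z < 1"
  shows "(\<lambda>k. herglotz_coeff \<zeta> k * z ^ k) sums herglotz \<zeta> z"
proof -
  have \<zeta>1: "\<zeta> * cnj \<zeta> = 1" using \<zeta> by (simp add: complex_norm_square[symmetric])
  have ne: "\<zeta> \<noteq> z" using \<zeta> z by auto
  have "(\<lambda>k. 2 * (cnj \<zeta> * z) ^ k - (if k = 0 then 1 else 0)) sums (2 * (1 / (1 - cnj \<zeta> * z)) - 1)"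
    using \<zeta> z sums_single[of 0 "\<lambda>_. 1::complex"]
    by (intro sums_diff sums_mult geometric_sums) (auto simp: norm_mult)
  also have "(\<lambda>k. 2 * (cnj \<zeta> * z) ^ k - (if k = 0 then 1 else 0)) = (\<lambda>k. herglotz_coeff \<zeta> k * z ^ k)"
    by (auto simp: herglotz_coeff_def power_mult_distrib)
  also have "2 * (1 / (1 - cnj \<zeta> * z)) - 1 = herglotz \<zeta> z"
  proof -
    have "1 - cnj \<zeta> * z = cnj \<zeta> * (\<zeta> - z)" using \<zeta>1 by (simp add: algebra_simps)
    moreover have "1 / cnj \<zeta> = \<zeta>" using \<zeta>1 by (metis eq_divide_imp mult_zero_right zero_neq_one)
    ultimately have "1 / (1 - cnj \<zeta> * z) = \<zeta> / (\<zeta> - z)" by (metis divide_divide_eq_left)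
    then have "2 * (1 / (1 - cnj \<zeta> * z)) - 1 = 2 * (\<zeta> / (\<zeta> - z)) - 1" by simp
    also have "\<dots> = herglotz \<zeta> z" using ne by (simp add: herglotz_def field_simps)
    finally show ?thesis .
  qed
  finally show ?thesis .
qed

lemma poisson_kernel_eq_herglotz:
  assumes \<zeta>: "cmod \<zeta> = 1" and z: "cmod z < 1"
  shows "complex_of_real (poisson_kernel \<zeta> z) = (herglotz \<zeta> z + cnj (herglotz \<zeta> z)) / 2"
proof -
  have ne: "\<zeta> - z \<noteq> 0" using \<zeta> z by auto
  have ne': "cnj \<zeta> - cnj z \<noteq> 0" using ne by (metis complex_cnj_diff complex_cnj_zero_iff)
  have \<zeta>1: "\<zeta> * cnj \<zeta> = 1" using \<zeta> by (simp add: complex_norm_square[symmetric])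
  have "complex_of_real (poisson_kernel \<zeta> z) = (1 - z * cnj z) / ((\<zeta> - z) * cnj (\<zeta> - z))"
    unfolding poisson_kernel_def norm_minus_commute[of z \<zeta>]
    by (simp only: of_real_divide of_real_diff of_real_1 complex_norm_square)
  also have "\<dots> = (herglotz \<zeta> z + cnj (herglotz \<zeta> z)) / 2"
  proof -
    have e: "(\<zeta> + z) * (cnj \<zeta> - cnj z) + (cnj \<zeta> + cnj z) * (\<zeta> - z) = 2 * (1 - z * cnj z)"
      using \<zeta>1 by (simp add: algebra_simps)
    have "herglotz \<zeta> z + cnj (herglotz \<zeta> z) = 2 * (1 - z * cnj z) / ((\<zeta> - z) * cnj (\<zeta> - z))"
      by (simp only: herglotz_def complex_cnj_divide complex_cnj_add complex_cnj_diff add_frac_eq[OF ne ne'] e)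
    then have "herglotz \<zeta> z + cnj (herglotz \<zeta> z) = 2 * ((1 - z * cnj z) / ((\<zeta> - z) * cnj (\<zeta> - z)))"
      by (simp only: times_divide_eq_right)
    then show ?thesis
      by (simp only: nonzero_mult_div_cancel_left[OF zero_neq_numeral[symmetric]])
  qed
  finally show ?thesis .
qed

lemma deriv_power_series_sums:
  assumes g: "\<And>z. cmod z < 1 \<Longrightarrow> (\<lambda>m. c m * z ^ m) sums g z" and z: "cmod z < 1"
  shows "(\<lambda>m. of_nat (Suc m) * c (Suc m) * z ^ m) sums deriv g z"
proof -
  have sm: "summable (\<lambda>m. c m * z ^ m)" if "cmod z < 1" for z using g[OF that] by (rule sums_summable)
  have "((\<lambda>z. \<Sum>m. c m * z ^ m) has_field_derivative (\<Sum>m. diffs c m * z ^ m)) (at z)"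
    using sm z by (rule termdiffs_strong')
  then have "(g has_field_derivative (\<Sum>m. diffs c m * z ^ m)) (at z)"
    by (rule has_field_derivative_transform_within_open[of _ _ _ "ball 0 1"])
       (use z g sums_unique in \<open>auto simp: sums_iff\<close>)
  then have "deriv g z = (\<Sum>m. diffs c m * z ^ m)" by (rule DERIV_imp_deriv)
  moreover have "summable (\<lambda>m. diffs c m * z ^ m)"
    by (rule termdiff_converges[of _ 1]) (use sm z in auto)
  ultimately show ?thesis by (simp add: diffs_def summable_sums)
qed


text \<open>The Poisson kernel is the real part of the Herglotz function, so the integral is half the sum of
  two pairings of power series.\<close>

lemma poisson_disc_integral:
  assumes g: "\<And>z. cmod z < 1 \<Longrightarrow> (\<lambda>m. c m * z ^ m) sums g z"
    and \<zeta>: "cmod \<zeta> = 1" and R: "0 < R" "R < 1"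
  shows "\<zeta> ^ Suc b * of_nat (Suc b) *
      (LINT z : ball 0 R | lborel. deriv g z * cnj z ^ b * of_real (poisson_kernel \<zeta> z)) / of_real pi =
    of_nat (Suc b) * g (of_real (R\<^sup>2) * \<zeta>) -
    (\<Sum>m\<le>b. (of_nat (Suc b) * of_real R ^ (2*m) - of_nat m * of_real R ^ (2 * Suc b)) * (c m * \<zeta> ^ m))"
proof -
  let ?B = "ball (0::complex) R"
  define g' where "g' = (\<lambda>m. of_nat (Suc m) * c (Suc m))"
  define h where "h = herglotz_coeff \<zeta>"
  define r where "r = complex_of_real R"
  have \<zeta>1: "\<zeta> * cnj \<zeta> = 1" using \<zeta> by (simp add: complex_norm_square[symmetric])
  have \<zeta>k: "\<zeta> ^ k * cnj \<zeta> ^ k = 1" for k using \<zeta>1 by (metis power_mult_distrib power_one)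
  have dg: "(\<lambda>m. g' m * z ^ m) sums deriv g z" if "cmod z < 1" for z
    unfolding g'_def using deriv_power_series_sums[OF g that] .
  have hz: "(\<lambda>m. h m * z ^ m) sums herglotz \<zeta> z" if "cmod z < 1" for z
    unfolding h_def using herglotz_sums[OF \<zeta> that] .
  define C where "C = (\<lambda>k. \<Sum>i\<le>k. g' i * h (k - i))"
  have dgh: "(\<lambda>k. C k * z ^ k) sums (deriv g z * herglotz \<zeta> z)" if z: "cmod z < 1" for z
  proof -
    have x: "cmod (of_real ((cmod z + 1) / 2)) < 1" using z by (simp del: of_real_add of_real_divide)
    have "(\<lambda>k. \<Sum>i\<le>k. (g' i * z ^ i) * (h (k - i) * z ^ (k - i))) sums
        ((\<Sum>k. g' k * z ^ k) * (\<Sum>k. h k * z ^ k))"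
      using z by (intro Cauchy_product_sums powser_insidea[OF sums_summable[OF dg[OF x]]]
          powser_insidea[OF sums_summable[OF hz[OF x]]]) (simp_all del: of_real_add of_real_divide)
    moreover have "(\<Sum>i\<le>k. (g' i * z ^ i) * (h (k - i) * z ^ (k - i))) = C k * z ^ k" for k
      unfolding C_def sum_distrib_right
    proof (rule sum.cong[OF refl])
      fix i assume "i \<in> {..k}"
      then have "z ^ k = z ^ i * z ^ (k - i)" by (simp flip: power_add)
      then show "(g' i * z ^ i) * (h (k - i) * z ^ (k - i)) = g' i * h (k - i) * z ^ k" by simp
    qed
    ultimately show ?thesis using sums_unique[OF dg[OF z]] sums_unique[OF hz[OF z]] by simp
  qed
  define hb where "hb = (\<lambda>q. if q < b then 0 else h (q - b))"
  have hzb: "(\<lambda>q. hb q * z ^ q) sums (herglotz \<zeta> z * z ^ b)" if z: "cmod z < 1" for z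
  proof -
    have "(\<lambda>q. hb (q + b) * z ^ (q + b)) sums (herglotz \<zeta> z * z ^ b)"
      using sums_mult2[OF hz[OF z], of "z ^ b"] by (simp add: hb_def power_add mult_ac)
    moreover have "(\<Sum>q<b. hb q * z ^ q) = 0" by (simp add: hb_def)
    ultimately show ?thesis using sums_iff_shift[of "\<lambda>q. hb q * z ^ q" b] by simp
  qed
  have icont: "set_integrable lborel ?B F" if "continuous_on (ball 0 1) F" for F :: "complex \<Rightarrow> complex"
    using set_integrable_disc_continuous[OF that R(2)] .
  have cg: "continuous_on (ball 0 1) (deriv g)" and ch: "continuous_on (ball 0 1) (herglotz \<zeta>)"
    using sums_power_continuous_on_disc[OF dg] sums_power_continuous_on_disc[OF hz] by auto
  \<comment> \<open>The holomorphic half of the kernel is multiplied into \<open>deriv g\<close>,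
    its conjugate half into \<open>cnj z ^ b\<close>. \<open>I1\<close> thus picks a single Cauchy
    product coefficient, whereas \<open>I2\<close> is an infinite pairing.\<close>
  define I1 where "I1 = (LINT z : ?B | lborel. (deriv g z * herglotz \<zeta> z) * cnj z ^ b)"
  define I2 where "I2 = (LINT z : ?B | lborel. deriv g z * cnj (herglotz \<zeta> z * z ^ b))"
  have "(LINT z : ?B | lborel. deriv g z * cnj z ^ b * of_real (poisson_kernel \<zeta> z)) =
      (LINT z : ?B | lborel. (deriv g z * herglotz \<zeta> z) * cnj z ^ b / 2 + deriv g z * cnj (herglotz \<zeta> z * z ^ b) / 2)"
    using R by (intro set_lebesgue_integral_cong) (auto simp: poisson_kernel_eq_herglotz[OF \<zeta>] field_simps)
  also have "\<dots> = I1 / 2 + I2 / 2"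
    unfolding I1_def I2_def
    by (subst set_integral_add) (auto intro!: icont continuous_intros cg ch)
  finally have I: "(LINT z : ?B | lborel. deriv g z * cnj z ^ b * of_real (poisson_kernel \<zeta> z)) = (I1 + I2) / 2"
    by simp
  have I1: "I1 = C b * complex_of_real (pi * R ^ (2*b+2) / (b+1))"
    unfolding I1_def by (rule disc_integral_mult_cnj_power[OF dgh R])
  have zk: "\<zeta> ^ Suc b * cnj \<zeta> ^ (b - i) = \<zeta> ^ Suc i" if "i \<le> b" for i
  proof -
    have "\<zeta> ^ Suc b = \<zeta> ^ Suc i * \<zeta> ^ (b - i)" using that by (simp flip: power_add)
    then have "\<zeta> ^ Suc b * cnj \<zeta> ^ (b - i) = \<zeta> ^ Suc i * (\<zeta> ^ (b - i) * cnj \<zeta> ^ (b - i))"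
      by (simp only: mult.assoc)
    then show ?thesis by (simp only: \<zeta>k mult_1_right)
  qed
  define G where "G = (\<lambda>m. c m * \<zeta> ^ m)"
  have C: "\<zeta> ^ Suc b * C b = 2 * (\<Sum>m\<le>b. of_nat m * G m) + of_nat (Suc b) * G (Suc b)"
  proof -
    have "\<zeta> ^ Suc b * C b = (\<Sum>i\<le>b. g' i * (\<zeta> ^ Suc b * h (b - i)))"
      unfolding C_def sum_distrib_left by (simp add: mult_ac)
    \<comment> \<open>The Herglotz coefficient at 0 is 1 and not 2, which costs one correction at
      \<open>i = b\<close>; \<open>T\<close> below contains the same kind of correction.\<close>
    also have "\<dots> = (\<Sum>i\<le>b. 2 * (g' i * \<zeta> ^ Suc i) - (if i = b then g' b * \<zeta> ^ Suc b else 0))"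
      using zk by (intro sum.cong refl) (auto simp: h_def herglotz_coeff_def algebra_simps simp del: power_Suc)
    also have "\<dots> = 2 * (\<Sum>i\<le>b. of_nat (Suc i) * G (Suc i)) - of_nat (Suc b) * G (Suc b)"
      by (simp add: sum_subtractf sum_distrib_left g'_def G_def mult_ac del: power_Suc of_nat_Suc)
    also have "(\<Sum>i\<le>b. of_nat (Suc i) * G (Suc i)) = (\<Sum>m\<le>b. of_nat m * G m) + of_nat (Suc b) * G (Suc b)"
      using sum.atMost_Suc_shift[of "\<lambda>m. of_nat m * G m" b] by simp
    finally show ?thesis by (simp add: algebra_simps)
  qed
  have I1': "\<zeta> ^ Suc b * of_nat (Suc b) * I1 / of_real pi =
      r ^ (2 * Suc b) * (2 * (\<Sum>m\<le>b. of_nat m * G m) + of_nat (Suc b) * G (Suc b))"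
  proof -
    have "complex_of_real (pi * R ^ (2*b+2) / (b+1)) = of_real pi * r ^ (2 * Suc b) / of_nat (Suc b)"
      by (simp add: r_def)
    then have "\<zeta> ^ Suc b * of_nat (Suc b) * I1 / of_real pi = r ^ (2 * Suc b) * (\<zeta> ^ Suc b * C b)"
      by (simp only: I1) (simp add: field_simps del: power_Suc of_nat_Suc)
    then show ?thesis unfolding C .
  qed
  have I2: "(\<lambda>q. g' q * cnj (hb q) * complex_of_real (pi * R ^ (2*q+2) / (q+1))) sums I2"
    unfolding I2_def by (rule disc_integral_pairing[OF dg hzb R])
  define T where "T = (\<lambda>q. if q < b then 0 else 2 * (G (Suc q) * r ^ (2 * Suc q)) -
      (if q = b then G (Suc b) * r ^ (2 * Suc b) else 0))"
  have "(\<lambda>q. \<zeta> ^ Suc b * (g' q * cnj (hb q) * complex_of_real (pi * R ^ (2*q+2) / (q+1))) / of_real pi) sums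
      (\<zeta> ^ Suc b * I2 / of_real pi)"
    using sums_divide[OF sums_mult[OF I2, of "\<zeta> ^ Suc b"], of "of_real pi"] by simp
  moreover have "\<zeta> ^ Suc b * (g' q * cnj (hb q) * complex_of_real (pi * R ^ (2*q+2) / (q+1))) / of_real pi = T q" for q
  proof (cases "q < b")
    case False
    then have e: "\<zeta> ^ Suc b * \<zeta> ^ (q - b) = \<zeta> ^ Suc q" by (simp flip: power_add)
    have "complex_of_real (pi * R ^ (2*q+2) / (q+1)) = of_real pi * r ^ (2 * Suc q) / of_nat (Suc q)"
      by (simp add: r_def)
    then have "\<zeta> ^ Suc b * (g' q * cnj (hb q) * complex_of_real (pi * R ^ (2*q+2) / (q+1))) / of_real pi =
      (\<zeta> ^ Suc b * cnj (hb q)) * c (Suc q) * r ^ (2 * Suc q)"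
      by (simp only:) (simp add: g'_def field_simps del: power_Suc of_nat_Suc)
    also have "\<zeta> ^ Suc b * cnj (hb q) = 2 * \<zeta> ^ Suc q - (if q = b then \<zeta> ^ Suc b else 0)"
      using False e by (auto simp: hb_def h_def herglotz_coeff_def)
    also have "(2 * \<zeta> ^ Suc q - (if q = b then \<zeta> ^ Suc b else 0)) * c (Suc q) * r ^ (2 * Suc q) = T q"
      using False by (cases "q = b") (simp_all add: T_def G_def algebra_simps)
    finally show ?thesis .
  qed (simp add: T_def hb_def)
  ultimately have T1: "T sums (\<zeta> ^ Suc b * I2 / of_real pi)" by simp
  \<comment> \<open>The radial factors of the disc moments turn the formal series at the boundary
    point \<open>\<zeta>\<close> into a value of \<open>g\<close> inside the disc.\<close>
  have gs: "(\<lambda>m. G m * r ^ (2*m)) sums g (of_real (R\<^sup>2) * \<zeta>)"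
  proof -
    have "cmod (of_real (R\<^sup>2) * \<zeta>) < 1" using R \<zeta> by (simp add: norm_mult norm_power abs_square_less_1)
    moreover have "G m * r ^ (2*m) = c m * (of_real (R\<^sup>2) * \<zeta>) ^ m" for m
      by (simp add: G_def r_def power_mult_distrib mult_ac flip: power_mult)
    ultimately show ?thesis using g by simp
  qed
  have "(\<lambda>q. G (q + Suc b) * r ^ (2*(q + Suc b))) sums (g (of_real (R\<^sup>2) * \<zeta>) - (\<Sum>m\<le>b. G m * r ^ (2*m)))"
    using sums_iff_shift[of "\<lambda>m. G m * r ^ (2*m)" "Suc b"] gs
    by (metis (no_types, lifting) diff_add_cancel lessThan_Suc_atMost)
  then have "(\<lambda>q. 2 * (G (q + Suc b) * r ^ (2*(q + Suc b))) - (if q = 0 then G (Suc b) * r ^ (2 * Suc b) else 0)) sums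
     (2 * (g (of_real (R\<^sup>2) * \<zeta>) - (\<Sum>m\<le>b. G m * r ^ (2*m))) - G (Suc b) * r ^ (2 * Suc b))"
    by (intro sums_diff sums_mult sums_single)
  then have "(\<lambda>q. T (q + b)) sums
     (2 * (g (of_real (R\<^sup>2) * \<zeta>) - (\<Sum>m\<le>b. G m * r ^ (2*m))) - G (Suc b) * r ^ (2 * Suc b))"
    by (simp add: T_def)
  moreover have "(\<Sum>q<b. T q) = 0" by (simp add: T_def)
  ultimately have T2: "T sums
     (2 * (g (of_real (R\<^sup>2) * \<zeta>) - (\<Sum>m\<le>b. G m * r ^ (2*m))) - G (Suc b) * r ^ (2 * Suc b))"
    using sums_iff_shift[of T b] by simp
  have I2': "\<zeta> ^ Suc b * I2 / of_real pi =
      2 * (g (of_real (R\<^sup>2) * \<zeta>) - (\<Sum>m\<le>b. G m * r ^ (2*m))) - G (Suc b) * r ^ (2 * Suc b)"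
    using sums_unique2[OF T1 T2] .
  have "\<zeta> ^ Suc b * of_nat (Suc b) * ((I1 + I2) / 2) / of_real pi =
    (\<zeta> ^ Suc b * of_nat (Suc b) * I1 / of_real pi + of_nat (Suc b) * (\<zeta> ^ Suc b * I2 / of_real pi)) / 2"
    by (simp add: field_simps del: power_Suc of_nat_Suc)
  \<comment> \<open>The corrections at index \<open>Suc b\<close> in \<open>I1'\<close> and
    \<open>I2'\<close> cancel.\<close>
  also have "\<dots> = r ^ (2 * Suc b) * (\<Sum>m\<le>b. of_nat m * G m) +
      of_nat (Suc b) * (g (of_real (R\<^sup>2) * \<zeta>) - (\<Sum>m\<le>b. G m * r ^ (2*m)))"
    unfolding I1' I2' by (simp add: field_simps del: power_Suc of_nat_Suc)
  also have "\<dots> = of_nat (Suc b) * g (of_real (R\<^sup>2) * \<zeta>) -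
    (\<Sum>m\<le>b. (of_nat (Suc b) * r ^ (2*m) - of_nat m * r ^ (2 * Suc b)) * G m)"
    by (simp add: sum_subtractf sum_distrib_left sum_distrib_right algebra_simps del: power_Suc of_nat_Suc)
  finally show ?thesis unfolding I r_def G_def .
qed


section \<open>Exhaustion of the disc and radial limits at a mass point\<close>

definition radius :: "nat \<Rightarrow> real" where "radius N = 1 - 1 / (real N + 2)"

lemma radius: "0 < radius N" "radius N < 1" "radius \<longlonglongrightarrow> 1" "incseq radius"
proof -
  show "0 < radius N" "radius N < 1" by (auto simp: radius_def field_simps)
  show "radius \<longlonglongrightarrow> 1"
    using tendsto_diff[OF tendsto_const LIMSEQ_ignore_initial_segment[OF lim_inverse_n', of 2], of 1]
    by (simp add: radius_def[abs_def] add.commute)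
  show "incseq radius" by (auto simp: incseq_def radius_def field_simps)
qed

lemma UN_ball_radius: "(\<Union>N. ball (0::complex) (radius N)) = ball 0 1"
proof (intro equalityI subsetI)
  fix z :: complex assume "z \<in> ball 0 1"
  then have "eventually (\<lambda>N. cmod z < radius N) sequentially"
    using radius(3) by (intro order_tendstoD(1)) auto
  then show "z \<in> (\<Union>N. ball 0 (radius N))" by (auto simp: eventually_sequentially)
qed (use radius(2) in \<open>fastforce simp: intro: less_trans\<close>)

lemma set_integral_tendsto_disc:
  fixes f :: "complex \<Rightarrow> complex"
  assumes "set_integrable lborel (ball 0 1) f"
  shows "(\<lambda>N. LINT z:ball 0 (radius N)|lborel. f z) \<longlonglongrightarrow> (LINT z:ball 0 1|lborel. f z)"
  using set_integral_cont_up[of "\<lambda>N. ball (0::complex) (radius N)" lborel f] assms radius(4)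
  unfolding UN_ball_radius by (auto simp: incseq_def subset_ball)

text \<open>Monotone convergence along the exhausting discs; \<open>poisson_disc_integral\<close>
  for the identity function and \<open>b = 0\<close> evaluates the integral over each of
  them.\<close>

lemma poisson_kernel_integrable:
  assumes \<zeta>: "cmod \<zeta> = 1"
  shows "set_integrable lborel (ball 0 1) (poisson_kernel \<zeta>)"
  unfolding set_integrable_def
proof (rule integrable_monotone_convergence)
  let ?f = "\<lambda>N z. indicat_real (ball 0 (radius N)) z *\<^sub>R poisson_kernel \<zeta> z"
  have c: "continuous_on (ball 0 1) (\<lambda>z. complex_of_real (poisson_kernel \<zeta> z))"
    by (intro continuous_intros continuous_on_poisson_kernel \<zeta>)
  have "set_integrable lborel (ball 0 (radius N)) (\<lambda>z. complex_of_real (poisson_kernel \<zeta> z))" for N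
    by (rule set_integrable_disc_continuous[OF c radius(2)])
  then have "integrable lborel (\<lambda>z. complex_of_real (?f N z))" for N
    by (simp add: set_integrable_def scaleR_conv_of_real)
  then show fi: "integrable lborel (?f N)" for N
    using complex_of_real_integrable_eq by blast
  show "AE z in lborel. mono (\<lambda>N. ?f N z)"
  proof (intro AE_I2 monoI)
    fix z :: complex and m n :: nat assume "m \<le> n"
    then have "radius m \<le> radius n" using radius(4) by (simp add: incseq_def)
    then show "?f m z \<le> ?f n z"
      using poisson_kernel_nonneg[of z \<zeta>] radius(2)[of n] by (auto simp: indicator_def)
  qed
  show "AE z in lborel. (\<lambda>N. ?f N z) \<longlonglongrightarrow> indicat_real (ball 0 1) z *\<^sub>R poisson_kernel \<zeta> z"
  proof (rule AE_I2)
    fix z :: complex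
    have "(\<lambda>N. indicat_real (ball 0 (radius N)) z) \<longlonglongrightarrow> indicat_real (\<Union>N. ball 0 (radius N)) z"
      using radius(4) by (intro LIMSEQ_indicator_incseq) (auto simp: incseq_def subset_ball)
    then show "(\<lambda>N. ?f N z) \<longlonglongrightarrow> indicat_real (ball 0 1) z *\<^sub>R poisson_kernel \<zeta> z"
      unfolding UN_ball_radius by (intro tendsto_intros)
  qed
  have "(\<integral>z. ?f N z \<partial>lborel) = pi * (radius N)\<^sup>2" for N
  proof -
    have id: "(\<lambda>m. (if m = 1 then 1 else 0) * z ^ m) sums z" for z :: complex
      using sums_single[of 1 "\<lambda>m. z ^ m"] by (simp add: if_distrib[of "\<lambda>x. x * _"] cong: if_cong)
    have "(LINT z : ball 0 (radius N) | lborel. complex_of_real (poisson_kernel \<zeta> z)) = of_real (pi * (radius N)\<^sup>2)"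
      using poisson_disc_integral[of "\<lambda>m. if m = 1 then 1 else 0" "\<lambda>z. z" \<zeta> "radius N" 0, OF id \<zeta> radius(1,2)] \<zeta>
      by (auto simp: field_simps)
    then show ?thesis
      unfolding set_integral_complex_of_real of_real_eq_iff by (simp add: set_lebesgue_integral_def)
  qed
  moreover have "(\<lambda>N. pi * (radius N)\<^sup>2) \<longlonglongrightarrow> pi * 1\<^sup>2"
    by (intro tendsto_intros radius)
  ultimately show "(\<lambda>N. \<integral>z. ?f N z \<partial>lborel) \<longlonglongrightarrow> pi" by simp
  show "(\<lambda>z. indicat_real (ball 0 1) z *\<^sub>R poisson_kernel \<zeta> z) \<in> borel_measurable lborel"
    using borel_measurable_continuous_on_indicator[OF _ continuous_on_poisson_kernel[OF \<zeta>]] by simp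
qed

text \<open>Integrability of the left-hand sides forces convergence along the radius; the case \<open>n = 1\<close> identifies the limit.\<close>

theorem poisson_boundary_value:
  assumes g: "\<And>z. cmod z < 1 \<Longrightarrow> (\<lambda>m. c m * z ^ m) sums g z" and \<zeta>: "cmod \<zeta> = 1"
    and int: "set_integrable lborel (ball 0 1) (\<lambda>z. deriv g z * of_real (poisson_kernel \<zeta> z))"
  obtains L where "(\<lambda>N. g (of_real ((radius N)\<^sup>2) * \<zeta>)) \<longlonglongrightarrow> L"
    "\<And>n. \<zeta> ^ n * of_nat n *
      (LINT z : ball 0 1 | lborel. deriv g z * cnj z ^ (n - 1) * of_real (poisson_kernel \<zeta> z)) / of_real pi =
      of_nat n * L - (\<Sum>m<n. of_nat (n - m) * (c m * \<zeta> ^ m))"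
proof -
  let ?I = "\<lambda>S b. LINT z : S | lborel. deriv g z * cnj z ^ b * of_real (poisson_kernel \<zeta> z)"
  define Q where "Q = (\<lambda>b N. \<Sum>m\<le>b. (of_nat (Suc b) * of_real (radius N) ^ (2*m) - of_nat m * of_real (radius N) ^ (2 * Suc b)) * (c m * \<zeta> ^ m))"
  define Q1 where "Q1 = (\<lambda>b. \<Sum>m\<le>b. of_nat (Suc b - m) * (c m * \<zeta> ^ m))"
  define J where "J = (\<lambda>b. \<zeta> ^ Suc b * of_nat (Suc b) * ?I (ball 0 1) b / of_real pi)"
  have intb: "set_integrable lborel (ball 0 1) (\<lambda>z. deriv g z * cnj z ^ b * of_real (poisson_kernel \<zeta> z))" for b
    unfolding set_integrable_def
  proof (rule Bochner_Integration.integrable_bound[OF int[unfolded set_integrable_def]])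
    show "AE z in lborel. norm (indicat_real (ball 0 1) z *\<^sub>R (deriv g z * cnj z ^ b * of_real (poisson_kernel \<zeta> z)))
      \<le> norm (indicat_real (ball 0 1) z *\<^sub>R (deriv g z * of_real (poisson_kernel \<zeta> z)))"
      by (intro AE_I2) (auto simp: indicator_def norm_mult norm_power power_le_one
          intro!: mult_right_mono mult_left_le)
    have "(\<lambda>z. (indicat_real (ball 0 1) z *\<^sub>R (deriv g z * of_real (poisson_kernel \<zeta> z))) * cnj z ^ b) \<in> borel_measurable lborel"
      using borel_measurable_integrable[OF int[unfolded set_integrable_def]]
      by measurable
    then show "(\<lambda>z. indicat_real (ball 0 1) z *\<^sub>R (deriv g z * cnj z ^ b * of_real (poisson_kernel \<zeta> z))) \<in> borel_measurable lborel"
      by (simp add: mult_ac)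
  qed
  have JN: "(\<lambda>N. of_nat (Suc b) * g (of_real ((radius N)\<^sup>2) * \<zeta>) - Q b N) \<longlonglongrightarrow> J b" for b
  proof -
    have "(\<lambda>N. \<zeta> ^ Suc b * of_nat (Suc b) * ?I (ball 0 (radius N)) b / of_real pi) \<longlonglongrightarrow> J b"
      unfolding J_def by (intro tendsto_intros set_integral_tendsto_disc intb) auto
    moreover have "\<zeta> ^ Suc b * of_nat (Suc b) * ?I (ball 0 (radius N)) b / of_real pi =
        of_nat (Suc b) * g (of_real ((radius N)\<^sup>2) * \<zeta>) - Q b N" for N
      unfolding Q_def by (rule poisson_disc_integral[OF g \<zeta> radius(1,2)])
    ultimately show ?thesis by (simp only:)
  qed
  have QN: "Q b \<longlonglongrightarrow> Q1 b" for b
  proof -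
    have "Q b \<longlonglongrightarrow> (\<Sum>m\<le>b. (of_nat (Suc b) * of_real 1 ^ (2*m) - of_nat m * of_real 1 ^ (2 * Suc b)) * (c m * \<zeta> ^ m))"
      unfolding Q_def by (intro tendsto_intros radius)
    also have "(\<Sum>m\<le>b. (of_nat (Suc b) * of_real 1 ^ (2*m) - of_nat m * of_real 1 ^ (2 * Suc b)) * (c m * \<zeta> ^ m)) = Q1 b"
      unfolding Q1_def by (intro sum.cong) (auto simp: of_nat_diff simp del: of_nat_Suc)
    finally show ?thesis .
  qed
  define L where "L = J 0 + Q1 0"
  have L: "(\<lambda>N. g (of_real ((radius N)\<^sup>2) * \<zeta>)) \<longlonglongrightarrow> L"
    using tendsto_add[OF JN[of 0] QN[of 0]] by (simp add: L_def)
  have "J b = of_nat (Suc b) * L - Q1 b" for b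
    using JN[of b] by (rule LIMSEQ_unique) (intro tendsto_intros L QN)
  \<comment> \<open>For \<open>n = 0\<close> the exponent \<open>n - 1\<close> is truncated, but
    both sides vanish; otherwise \<open>b = n - 1\<close>.\<close>
  then have "\<zeta> ^ n * of_nat n * ?I (ball 0 1) (n - 1) / of_real pi =
      of_nat n * L - (\<Sum>m<n. of_nat (n - m) * (c m * \<zeta> ^ m))" for n
    by (cases n) (simp_all add: J_def Q1_def lessThan_Suc_atMost del: power_Suc of_nat_Suc)
  with L show ?thesis by (rule that)
qed

text \<open>The bracket satisfies \<open>y (l + 2) - 2 * y (l + 1) + y l = - 9 * H (l + 1)\<close>, and summing this against \<open>r ^ l\<close>
  eliminates \<open>H\<close> exactly because \<open>(1 - r)\<^sup>2 = 9 * r\<close>.\<close>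

lemma kernel_series:
  fixes H :: "nat \<Rightarrow> complex" and e :: complex
  assumes r: "0 < r" "r < 1" "r\<^sup>2 - 11 * r + 1 = (0::real)"
    and H: "summable (\<lambda>l. of_real r ^ l * H l)"
    and x: "(\<lambda>l. of_real r ^ l * (H l + 3 * of_nat (3 * l + j) * e - (\<Sum>k<l. 9 * of_nat (l - k) * H k))) sums S"
  shows "S = (1 + 3 * of_nat j / (1 - of_real r)) * e"
proof -
  define \<rho> where "\<rho> = complex_of_real r"
  have \<rho>: "\<rho> \<noteq> 0" "1 - \<rho> \<noteq> 0" and \<rho>2: "(1 - \<rho>)\<^sup>2 = 9 * \<rho>"
  proof -
    show "\<rho> \<noteq> 0" "1 - \<rho> \<noteq> 0" using r by (auto simp: \<rho>_def)
    have "(1 - r)\<^sup>2 = 9 * r" using r by (simp add: power2_eq_square algebra_simps)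
    then have "complex_of_real ((1 - r)\<^sup>2) = complex_of_real (9 * r)" by (rule arg_cong)
    then show "(1 - \<rho>)\<^sup>2 = 9 * \<rho>" by (simp add: \<rho>_def)
  qed
  define y where "y = (\<lambda>l. 3 * of_nat (3 * l + j) * e - (\<Sum>k<l. 9 * of_nat (l - k) * H k))"
  define T where "T = (\<Sum>l. \<rho> ^ l * H l)"
  have Hs: "(\<lambda>l. \<rho> ^ l * H l) sums T"
    unfolding T_def using H by (simp add: \<rho>_def summable_sums)
  define Y where "Y = S - T"
  have Ys: "(\<lambda>l. \<rho> ^ l * y l) sums Y"
    using sums_diff[OF x Hs[unfolded \<rho>_def]] by (simp add: \<rho>_def y_def Y_def algebra_simps)
  have y0: "y 0 = 3 * of_nat j * e" by (simp add: y_def)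
  have y1: "y 1 = 9 * e + 3 * of_nat j * e - 9 * H 0" by (simp add: y_def algebra_simps)
  have rec: "y (Suc (Suc l)) = 2 * y (Suc l) - y l - 9 * H (Suc l)" for l
  proof -
    have a: "(\<Sum>k<Suc l. 9 * of_nat (Suc (Suc l) - k) * H k) = (\<Sum>k<l. 9 * of_nat (Suc (Suc l) - k) * H k) + 18 * H l"
      by simp
    have b: "(\<Sum>k<l. 9 * of_nat (Suc (Suc l) - k) * H k) =
      2 * (\<Sum>k<l. 9 * of_nat (Suc l - k) * H k) - (\<Sum>k<l. 9 * of_nat (l - k) * H k)"
      unfolding sum_distrib_left sum_subtractf[symmetric]
      by (intro sum.cong) (auto simp: of_nat_diff algebra_simps)
    show ?thesis
      unfolding y_def sum.lessThan_Suc[of _ "Suc l"] a b sum.lessThan_Suc[of _ l]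
      by (simp add: algebra_simps)
  qed
  have Ys1: "(\<lambda>l. \<rho> ^ Suc l * y (Suc l)) sums (Y - y 0)"
    using Ys sums_Suc_iff[of "\<lambda>l. \<rho> ^ l * y l"] by simp
  then have Ys2: "(\<lambda>l. \<rho> ^ Suc (Suc l) * y (Suc (Suc l))) sums (Y - y 0 - \<rho> * y 1)"
    using sums_Suc_iff[of "\<lambda>l. \<rho> ^ Suc l * y (Suc l)"] by simp
  have Hs1: "(\<lambda>l. \<rho> ^ Suc l * H (Suc l)) sums (T - H 0)"
    using Hs sums_Suc_iff[of "\<lambda>l. \<rho> ^ l * H l"] by simp
  have "(\<lambda>l. 2 * \<rho> * (\<rho> ^ Suc l * y (Suc l)) - \<rho>\<^sup>2 * (\<rho> ^ l * y l) - 9 * \<rho> * (\<rho> ^ Suc l * H (Suc l))) sums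
      (2 * \<rho> * (Y - y 0) - \<rho>\<^sup>2 * Y - 9 * \<rho> * (T - H 0))"
    by (intro sums_diff sums_mult Ys Ys1 Hs1)
  also have "(\<lambda>l. 2 * \<rho> * (\<rho> ^ Suc l * y (Suc l)) - \<rho>\<^sup>2 * (\<rho> ^ l * y l) - 9 * \<rho> * (\<rho> ^ Suc l * H (Suc l))) =
    (\<lambda>l. \<rho> ^ Suc (Suc l) * y (Suc (Suc l)))"
    unfolding rec by (simp add: algebra_simps power2_eq_square)
  finally have "Y - y 0 - \<rho> * y 1 = 2 * \<rho> * (Y - y 0) - \<rho>\<^sup>2 * Y - 9 * \<rho> * (T - H 0)"
    using Ys2 sums_unique2 by blast
  then have "(1 - \<rho>)\<^sup>2 * Y = (1 - 2 * \<rho>) * y 0 + \<rho> * (y 1 + 9 * H 0) - 9 * \<rho> * T"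
    by (simp add: algebra_simps power2_eq_square)
  then have "9 * \<rho> * S = 9 * \<rho> * e + 3 * of_nat j * e * (1 - \<rho>)"
    unfolding \<rho>2 y0 y1 Y_def by (simp add: algebra_simps)
  also have "\<dots> = 9 * \<rho> * ((1 + 3 * of_nat j / (1 - \<rho>)) * e)"
  proof -
    have "9 * \<rho> / (1 - \<rho>) = 1 - \<rho>" using \<rho> by (simp add: power2_eq_square flip: \<rho>2)
    then have "9 * \<rho> * e + 3 * of_nat j * e * (1 - \<rho>) = 9 * \<rho> * e + 3 * of_nat j * e * (9 * \<rho> / (1 - \<rho>))"
      by (simp only:)
    then show ?thesis by (simp add: ring_distribs mult_ac)
  qed
  finally show ?thesis using \<rho> by (simp add: \<rho>_def)
qed

section \<open>Three equispaced point masses\<close>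

locale equispaced =
  fixes \<zeta> :: complex
  assumes \<zeta>: "cmod \<zeta> = 1"
begin

definition \<omega> :: complex where "\<omega> = exp (2 * of_real pi * \<i> / 3)"

lemma \<omega>: "cmod \<omega> = 1" "\<omega> ^ 3 = 1" "\<omega> \<noteq> 1" "1 + \<omega> + \<omega>\<^sup>2 = 0"
proof -
  have w: "\<omega> = cis (2 * pi / 3)" by (simp add: \<omega>_def cis_conv_exp mult_ac)
  show "cmod \<omega> = 1" by (simp add: w)
  show w3: "\<omega> ^ 3 = 1" by (simp add: w Complex.DeMoivre)
  show w1: "\<omega> \<noteq> 1" by (simp add: w complex_eq_iff cos_120)
  have "(\<omega> - 1) * (1 + \<omega> + \<omega>\<^sup>2) = 0" using w3 by (simp add: algebra_simps power2_eq_square power3_eq_cube)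
  then show "1 + \<omega> + \<omega>\<^sup>2 = 0" using w1 by simp
qed

lemma \<zeta>_cnj [simp]: "\<zeta> * cnj \<zeta> = 1" "cnj \<zeta> * \<zeta> = 1"
  using \<zeta> by (simp_all add: complex_norm_square[symmetric] mult.commute)

lemma \<zeta>_power_cnj [simp]: "\<zeta> ^ n * cnj \<zeta> ^ n = 1" "cnj \<zeta> ^ n * \<zeta> ^ n = 1"
  by (simp_all flip: power_mult_distrib)

definition pt :: "nat \<Rightarrow> complex" where "pt i = \<zeta> * \<omega> ^ i"

lemma cmod_pt [simp]: "cmod (pt i) = 1"
  by (simp add: pt_def norm_mult norm_power \<zeta> \<omega>)

abbreviation \<mu> :: "complex measure" where "\<mu> \<equiv> three_point_measure \<zeta>"

lemma sum_lessThan_3: "(\<Sum>i<3. f i) = f 0 + f 1 + f (2::nat)"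
  by (simp add: eval_nat_numeral)

lemma poisson_int_eq: "poisson_int \<mu> z = (\<Sum>i<3. poisson_kernel (pt i) z)"
proof -
  \<comment> \<open>The mass points must be distinct for the sum over the set to become a sum over
    three indices.\<close>
  have \<omega>2: "\<omega>\<^sup>2 \<noteq> 1" "\<omega>\<^sup>2 \<noteq> \<omega>" "\<omega> \<noteq> 0"
    using \<omega> by (auto simp: power2_eq_square) (metis mult.right_neutral mult_1 power3_eq_cube)
  have \<zeta>0: "\<zeta> \<noteq> 0" using \<zeta> by auto
  have "\<mu> = point_measure {\<zeta>, \<zeta> * \<omega>, \<zeta> * \<omega>\<^sup>2} (\<lambda>_. ennreal 1)"
    by (simp add: three_point_measure_def \<omega>_def Let_def)
  then have "poisson_int \<mu> z = (\<Sum>a\<in>{\<zeta>, \<zeta> * \<omega>, \<zeta> * \<omega>\<^sup>2}. 1 *\<^sub>R poisson_kernel a z)"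
    unfolding poisson_int_def poisson_kernel_def
    by (simp only: lebesgue_integral_point_measure_finite finite.intros)
  then show ?thesis
    using \<omega> \<omega>2 \<zeta>0 by (simp add: sum_lessThan_3 pt_def)
qed

lemma poisson_int_nonneg: "cmod z < 1 \<Longrightarrow> 0 \<le> poisson_int \<mu> z"
  unfolding poisson_int_eq by (intro sum_nonneg poisson_kernel_nonneg)

lemma poisson_kernel_le_poisson_int: "cmod z < 1 \<Longrightarrow> i < 3 \<Longrightarrow> poisson_kernel (pt i) z \<le> poisson_int \<mu> z"
  unfolding poisson_int_eq by (intro member_le_sum) (auto intro: poisson_kernel_nonneg)

lemma continuous_on_poisson_int: "continuous_on (ball 0 1) (poisson_int \<mu>)"
  unfolding poisson_int_eq[abs_def] by (intro continuous_intros continuous_on_poisson_kernel) simp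

lemma poisson_int_integrable: "set_integrable lborel (ball 0 1) (poisson_int \<mu>)"
  unfolding poisson_int_eq[abs_def] set_integrable_def scaleR_sum_right
  using poisson_kernel_integrable[unfolded set_integrable_def] by (intro Bochner_Integration.integrable_sum) auto

section \<open>Integrability and radial limits for members of \<open>Dspace \<mu>\<close>\<close>

lemma taylor_sums:
  assumes "g \<in> Dspace \<mu>" "cmod z < 1"
  shows "(\<lambda>m. taylor_coeff g m * z ^ m) sums g z"
  using holomorphic_power_series[of g 0 1 z] assms by (simp add: Dspace_def taylor_coeff_def)

lemma borel_measurable_ball_continuous:
  fixes F :: "complex \<Rightarrow> 'b::{real_normed_vector, second_countable_topology}"
  assumes "continuous_on (ball 0 1) F"
  shows "(\<lambda>z. indicat_real (ball 0 1) z *\<^sub>R F z) \<in> borel_measurable lborel"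
  using borel_measurable_continuous_on_indicator[OF _ assms] by simp

text \<open>Finite energy controls only the square of \<open>deriv g\<close>. Since t <= t^2 + 1 and
  the Poisson integral is itself integrable, the first power is controlled as well.\<close>

lemma deriv_poisson_integrable:
  assumes g: "g \<in> Dspace \<mu>"
  shows "set_integrable lborel (ball 0 1) (\<lambda>z. deriv g z * of_real (poisson_int \<mu> z))"
    and "i < 3 \<Longrightarrow> set_integrable lborel (ball 0 1) (\<lambda>z. deriv g z * of_real (poisson_kernel (pt i) z))"
proof -
  have cg: "continuous_on (ball 0 1) (deriv g)"
    using g holomorphic_deriv[of g "ball 0 1"] by (auto simp: Dspace_def intro: holomorphic_on_imp_continuous_on)
  define v where "v = (\<lambda>z. indicat_real (ball 0 1) z *\<^sub>R ((cmod (deriv g z))\<^sup>2 * poisson_int \<mu> z))"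
  have v: "integrable lborel v"
  proof (rule integrableI_bounded)
    show "v \<in> borel_measurable lborel" unfolding v_def
      by (intro borel_measurable_ball_continuous continuous_intros cg continuous_on_poisson_int)
    have eq: "ennreal (norm (v z)) = ennreal pi * (indicator (ball 0 1) z * ennreal ((cmod (deriv g z))\<^sup>2 * poisson_int \<mu> z / pi))" for z
      using poisson_int_nonneg[of z]
      by (auto simp: v_def indicator_def simp flip: ennreal_mult)
    have "(\<integral>\<^sup>+ z. ennreal (norm (v z)) \<partial>lborel) = 
      ennreal pi * (\<integral>\<^sup>+ z. indicator (ball 0 1) z * ennreal ((cmod (deriv g z))\<^sup>2 * poisson_int \<mu> z / pi) \<partial>lborel)"
      unfolding eq
    proof (rule nn_integral_cmult)
      have "(\<lambda>z. ennreal (indicat_real (ball 0 1) z *\<^sub>R ((cmod (deriv g z))\<^sup>2 * poisson_int \<mu> z / pi))) \<in> borel_measurable lborel"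
        by (intro measurable_ennreal[THEN measurable_compose[rotated]] borel_measurable_ball_continuous continuous_intros cg continuous_on_poisson_int) auto
      also have "(\<lambda>z. ennreal (indicat_real (ball 0 1) z *\<^sub>R ((cmod (deriv g z))\<^sup>2 * poisson_int \<mu> z / pi))) =
        (\<lambda>z. indicator (ball 0 1) z * ennreal ((cmod (deriv g z))\<^sup>2 * poisson_int \<mu> z / pi))"
        by (auto simp: indicator_def)
      finally show "\<dots> \<in> borel_measurable lborel" .
    qed
    also have "\<dots> < \<infinity>" using g by (simp add: Dspace_def ennreal_mult_less_top)
    finally show "(\<integral>\<^sup>+ z. ennreal (norm (v z)) \<partial>lborel) < \<infinity>" .
  qed
  have bound: "set_integrable lborel (ball 0 1) (\<lambda>z. deriv g z * of_real (p z))"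
    if p: "continuous_on (ball 0 1) p" "\<And>z. cmod z < 1 \<Longrightarrow> 0 \<le> p z \<and> p z \<le> poisson_int \<mu> z" for p :: "complex \<Rightarrow> real"
    unfolding set_integrable_def
  proof (rule Bochner_Integration.integrable_bound)
    show "integrable lborel (\<lambda>z. v z + indicat_real (ball 0 1) z *\<^sub>R poisson_int \<mu> z)"
      using poisson_int_integrable by (intro Bochner_Integration.integrable_add v) (simp add: set_integrable_def)
    show "(\<lambda>z. indicat_real (ball 0 1) z *\<^sub>R (deriv g z * of_real (p z))) \<in> borel_measurable lborel"
      by (intro borel_measurable_ball_continuous continuous_intros cg p)
    show "AE z in lborel. norm (indicat_real (ball 0 1) z *\<^sub>R (deriv g z * of_real (p z)))
      \<le> norm (v z + indicat_real (ball 0 1) z *\<^sub>R poisson_int \<mu> z)"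
    proof (rule AE_I2)
      fix z :: complex
      show "norm (indicat_real (ball 0 1) z *\<^sub>R (deriv g z * of_real (p z)))
        \<le> norm (v z + indicat_real (ball 0 1) z *\<^sub>R poisson_int \<mu> z)"
      proof (cases "cmod z < 1")
        case True
        have a: "x \<le> x\<^sup>2 + 1" for x :: real
          using zero_le_power2[of "x - 1/2"] by (simp add: power2_eq_square algebra_simps)
        have "cmod (deriv g z) * p z \<le> ((cmod (deriv g z))\<^sup>2 + 1) * poisson_int \<mu> z"
          using p(2)[OF True] a by (intro mult_mono) auto
        then show ?thesis using True p(2)[OF True] by (simp add: v_def norm_mult algebra_simps)
      qed (simp add: v_def)
    qed
  qed
  show "set_integrable lborel (ball 0 1) (\<lambda>z. deriv g z * of_real (poisson_int \<mu> z))"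
    by (rule bound) (auto intro: continuous_on_poisson_int poisson_int_nonneg)
  show "i < 3 \<Longrightarrow> set_integrable lborel (ball 0 1) (\<lambda>z. deriv g z * of_real (poisson_kernel (pt i) z))"
    by (rule bound) (auto intro: continuous_on_poisson_kernel poisson_kernel_nonneg poisson_kernel_le_poisson_int)
qed

text \<open>Radial limit at a mass point along the fixed sequence of radii; it exists for members of \<open>D(\<mu>)\<close>.\<close>

definition bval :: "(complex \<Rightarrow> complex) \<Rightarrow> nat \<Rightarrow> complex" where
  "bval g i = lim (\<lambda>N. g (of_real ((radius N)\<^sup>2) * pt i))"

lemma boundary_value:
  assumes g: "g \<in> Dspace \<mu>" and i: "i < 3"
  shows "(\<lambda>N. g (of_real ((radius N)\<^sup>2) * pt i)) \<longlonglongrightarrow> bval g i"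
    and "pt i ^ n * of_nat n *
      (LINT z : ball 0 1 | lborel. deriv g z * cnj z ^ (n - 1) * of_real (poisson_kernel (pt i) z)) / of_real pi =
      of_nat n * bval g i - (\<Sum>m<n. of_nat (n - m) * (taylor_coeff g m * pt i ^ m))"
proof -
  obtain L where L: "(\<lambda>N. g (of_real ((radius N)\<^sup>2) * pt i)) \<longlonglongrightarrow> L"
    "\<And>n. pt i ^ n * of_nat n *
      (LINT z : ball 0 1 | lborel. deriv g z * cnj z ^ (n - 1) * of_real (poisson_kernel (pt i) z)) / of_real pi =
      of_nat n * L - (\<Sum>m<n. of_nat (n - m) * (taylor_coeff g m * pt i ^ m))"
    using poisson_boundary_value[OF taylor_sums[OF g] cmod_pt deriv_poisson_integrable(2)[OF g i]] by blast
  then have "L = bval g i" by (simp add: bval_def limI)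
  then show "(\<lambda>N. g (of_real ((radius N)\<^sup>2) * pt i)) \<longlonglongrightarrow> bval g i"
    "pt i ^ n * of_nat n *
      (LINT z : ball 0 1 | lborel. deriv g z * cnj z ^ (n - 1) * of_real (poisson_kernel (pt i) z)) / of_real pi =
      of_nat n * bval g i - (\<Sum>m<n. of_nat (n - m) * (taylor_coeff g m * pt i ^ m))"
    using L by auto
qed

text \<open>Such series converge in the disc of radius 2, so boundary values are plain sums of
  coefficients. The rate 1/2 admits the kernels because \<open>r < 1/8\<close>, and the class is
  stable under \<open>shift\<close> and \<open>damp\<close>.\<close>

definition decaying :: "(nat \<Rightarrow> complex) \<Rightarrow> bool" where
  "decaying b \<longleftrightarrow> (\<exists>C. \<forall>n. cmod (b n) \<le> C * (1/2) ^ n)"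

text \<open>The factor \<open>cnj \<zeta>\<close> moves the first mass point to 1.\<close>

definition pfun :: "(nat \<Rightarrow> complex) \<Rightarrow> complex \<Rightarrow> complex" where
  "pfun b z = (if cmod z < 1 then \<Sum>n. b n * (cnj \<zeta> * z) ^ n else 0)"

lemma decaying_summable:
  assumes b: "decaying b" and x: "cmod x \<le> 3/2"
  shows "summable (\<lambda>n. cmod (b n * x ^ n))"
proof -
  obtain C where C: "\<And>n. cmod (b n) \<le> C * (1/2) ^ n" using b by (auto simp: decaying_def)
  have C0: "0 \<le> C" using C[of 0] norm_ge_zero[of "b 0"] by (simp del: norm_ge_zero)
  show ?thesis
  proof (rule summable_comparison_test'[of "\<lambda>n. C * (3/4) ^ n" 0])
    fix n
    have "cmod (b n * x ^ n) \<le> (C * (1/2) ^ n) * (3/2) ^ n"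
      unfolding norm_mult norm_power using C x C0 by (intro mult_mono power_mono) auto
    also have "\<dots> = C * (3/4) ^ n" by (simp flip: power_mult_distrib)
    finally show "norm (cmod (b n * x ^ n)) \<le> C * (3/4) ^ n" by simp
  qed simp
qed

lemma decaying_summable_of_nat: 
  assumes b: "decaying b"
  shows "summable (\<lambda>n. of_nat (Suc n) * cmod (b (Suc n)))"
proof -
  have "summable (\<lambda>n. diffs (\<lambda>n. complex_of_real (cmod (b n))) n * 1 ^ n)"
  proof (rule termdiff_converges)
    show "summable (\<lambda>n. complex_of_real (cmod (b n)) * x ^ n)" if "cmod x < 3/2" for x
    proof (rule summable_norm_cancel)
      show "summable (\<lambda>n. cmod (complex_of_real (cmod (b n)) * x ^ n))"
        using decaying_summable[OF b, of x] that by (simp add: norm_mult)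
    qed
  qed simp
  then have "summable (\<lambda>n. complex_of_real (of_nat (Suc n) * cmod (b (Suc n))))"
    by (simp add: diffs_def)
  then show ?thesis unfolding summable_of_real_iff .
qed

lemma pfun_sums:
  assumes b: "decaying b" and z: "cmod z < 1"
  shows "(\<lambda>n. (b n * cnj \<zeta> ^ n) * z ^ n) sums pfun b z"
proof -
  have "summable (\<lambda>n. b n * (cnj \<zeta> * z) ^ n)"
    using z by (intro summable_norm_cancel[OF decaying_summable[OF b]]) (simp add: norm_mult \<zeta>)
  then show ?thesis using z by (simp add: pfun_def power_mult_distrib mult_ac summable_sums)
qed

lemma taylor_coeff_unique:
  assumes "\<And>z. cmod z < 1 \<Longrightarrow> (\<lambda>n. a n * z ^ n) sums f z"
  shows "taylor_coeff f n = a n"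
proof -
  have "f has_fps_expansion Abs_fps a"
  proof (rule has_fps_expansionI)
    have "eventually (\<lambda>z. z \<in> ball (0::complex) 1) (nhds 0)"
      by (intro eventually_nhds_in_open) auto
    then show "eventually (\<lambda>z. (\<lambda>n. fps_nth (Abs_fps a) n * z ^ n) sums f z) (nhds 0)"
      by eventually_elim (use assms in auto)
  qed
  from fps_nth_fps_expansion[OF this, of n] show ?thesis by (simp add: taylor_coeff_def)
qed

lemma taylor_coeff_pfun: "decaying b \<Longrightarrow> taylor_coeff (pfun b) n = b n * cnj \<zeta> ^ n"
  by (intro taylor_coeff_unique pfun_sums)

lemma deriv_pfun_sums:
  "decaying b \<Longrightarrow> cmod z < 1 \<Longrightarrow>
   (\<lambda>n. of_nat (Suc n) * (b (Suc n) * cnj \<zeta> ^ Suc n) * z ^ n) sums deriv (pfun b) z"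
  by (rule deriv_power_series_sums[OF pfun_sums])

lemma deriv_pfun_term_le:
  "cmod z < 1 \<Longrightarrow> cmod (of_nat (Suc n) * (b (Suc n) * cnj \<zeta> ^ Suc n) * z ^ n) \<le> of_nat (Suc n) * cmod (b (Suc n))"
  using mult_left_mono[OF power_le_one[of "cmod z" n], of "of_nat (Suc n) * cmod (b (Suc n))"]
  by (simp add: norm_mult norm_power \<zeta> del: of_nat_Suc)

text \<open>The derivative is bounded on the disc and the Poisson integral is integrable.\<close>

lemma pfun_in_Dspace:
  assumes b: "decaying b"
  shows "pfun b \<in> Dspace \<mu>"
proof -
  define M where "M = (\<Sum>n. of_nat (Suc n) * cmod (b (Suc n)))"
  have M: "cmod (deriv (pfun b) z) \<le> M" if z: "cmod z < 1" for z
  proof -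
    have "deriv (pfun b) z = (\<Sum>n. of_nat (Suc n) * (b (Suc n) * cnj \<zeta> ^ Suc n) * z ^ n)"
      using deriv_pfun_sums[OF b z] sums_unique by blast
    also have "cmod \<dots> \<le> M"
      unfolding M_def using deriv_pfun_term_le[OF z] by (intro norm_suminf_le decaying_summable_of_nat b)
    finally show ?thesis .
  qed
  have hol: "pfun b holomorphic_on ball 0 1"
    using pfun_sums[OF b] by (intro power_series_holomorphic[of 0 1 "\<lambda>n. b n * cnj \<zeta> ^ n"]) auto
  have "(\<integral>\<^sup>+ z. indicator (ball 0 1) z * ennreal ((cmod (deriv (pfun b) z))\<^sup>2 * poisson_int \<mu> z / pi) \<partial>lborel)
    \<le> (\<integral>\<^sup>+ z. ennreal (M\<^sup>2 / pi * (indicat_real (ball 0 1) z *\<^sub>R poisson_int \<mu> z)) \<partial>lborel)"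
  proof (rule nn_integral_mono)
    fix z :: complex
    show "indicator (ball 0 1) z * ennreal ((cmod (deriv (pfun b) z))\<^sup>2 * poisson_int \<mu> z / pi)
      \<le> ennreal (M\<^sup>2 / pi * (indicat_real (ball 0 1) z *\<^sub>R poisson_int \<mu> z))"
      using M[of z] poisson_int_nonneg[of z]
      by (auto simp: indicator_def intro!: ennreal_leI divide_right_mono mult_right_mono power_mono)
  qed
  also have "\<dots> < \<infinity>"
    using poisson_int_integrable
    by (subst nn_integral_eq_integral) (auto simp: set_integrable_def indicator_def poisson_int_nonneg)
  finally show ?thesis using hol by (auto simp: Dspace_def pfun_def)
qed

text \<open>For \<open>g\<close> in \<open>D(\<mu>)\<close>, \<open>G g n\<close> and \<open>E g n\<close> are the Taylor coefficients and the discrete Fourier transform of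
  the boundary values, both after the rotation by \<open>\<zeta>\<close>, and \<open>X g n\<close> is the inner product of \<open>g\<close> with
  \<open>(cnj \<zeta> * z) ^ n\<close>.\<close>

definition G :: "(complex \<Rightarrow> complex) \<Rightarrow> nat \<Rightarrow> complex" where
  "G g n = taylor_coeff g n * \<zeta> ^ n"

definition E :: "(complex \<Rightarrow> complex) \<Rightarrow> nat \<Rightarrow> complex" where
  "E g n = (\<Sum>i<3. cnj \<omega> ^ (i * n) * bval g i) / 3"

definition X :: "(complex \<Rightarrow> complex) \<Rightarrow> nat \<Rightarrow> complex" where
  "X g n = G g n + 3 * of_nat n * E g n - (\<Sum>m<n. if 3 dvd n - m then 3 * of_nat (n - m) * G g m else 0)"

section \<open>Inner products with monomials and with decaying series\<close>

lemma \<omega>_cnj [simp]: "\<omega> * cnj \<omega> = 1" "cnj \<omega> * \<omega> = 1"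
  using \<omega>(1) by (simp_all add: complex_norm_square[symmetric] mult.commute)

lemma sum_\<omega>_powers: "(\<Sum>i<3. cnj \<omega> ^ (i * k)) = (if 3 dvd k then 3 else 0)"
proof -
  have c3: "cnj \<omega> ^ 3 = 1" using \<omega>(2) by (metis complex_cnj_one complex_cnj_power)
  have c1: "1 + cnj \<omega> + cnj \<omega> ^ 2 = 0" using \<omega>(4) by (metis complex_cnj_add complex_cnj_one complex_cnj_power complex_cnj_zero)
  have p: "cnj \<omega> ^ m = cnj \<omega> ^ (m mod 3)" for m
    by (metis c3 div_mult_mod_eq mult.left_neutral power_add power_mult power_one mult.commute)
  have "(\<Sum>i<3. cnj \<omega> ^ (i * k)) = 1 + cnj \<omega> ^ (k mod 3) + cnj \<omega> ^ ((2 * (k mod 3)) mod 3)"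
    using p[of k] p[of "2 * k"] by (simp add: sum_lessThan_3 mod_mult_right_eq)
  moreover have "k mod 3 = 0 \<or> k mod 3 = 1 \<or> k mod 3 = 2" by linarith
  ultimately show ?thesis
    using c1 by (auto simp: dvd_eq_mod_eq_0 power2_eq_square algebra_simps)
qed

text \<open>The left side is the energy part of the inner product of \<open>g\<close> with
  \<open>(cnj \<zeta> * z) ^ n\<close>. The boundary identities at the three mass points are added
  with weights \<open>cnj \<omega> ^ (i * n)\<close>, which filter out the Taylor coefficients
  outside the residue class of \<open>n\<close>.\<close>

lemma inner_power:
  assumes g: "g \<in> Dspace \<mu>"
  shows "\<zeta> ^ n * of_nat n * (LINT z : ball 0 1 | lborel. deriv g z * of_real (poisson_int \<mu> z / pi) * cnj z ^ (n - 1))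
    = X g n - G g n"
proof -
  let ?I = "\<lambda>i. LINT z : ball 0 1 | lborel. deriv g z * cnj z ^ (n - 1) * of_real (poisson_kernel (pt i) z)"
  have intb: "set_integrable lborel (ball 0 1) (\<lambda>z. deriv g z * cnj z ^ (n - 1) * of_real (poisson_kernel (pt i) z))" if "i < 3" for i
    unfolding set_integrable_def
  proof (rule Bochner_Integration.integrable_bound[OF deriv_poisson_integrable(2)[OF g that, unfolded set_integrable_def]])
    show "AE z in lborel. norm (indicat_real (ball 0 1) z *\<^sub>R (deriv g z * cnj z ^ (n-1) * of_real (poisson_kernel (pt i) z)))
      \<le> norm (indicat_real (ball 0 1) z *\<^sub>R (deriv g z * of_real (poisson_kernel (pt i) z)))"
      by (intro AE_I2) (auto simp: indicator_def norm_mult norm_power power_le_one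
          intro!: mult_right_mono mult_left_le)
    have "continuous_on (ball 0 1) (deriv g)"
      using g holomorphic_deriv[of g "ball 0 1"] by (auto simp: Dspace_def intro: holomorphic_on_imp_continuous_on)
    then show "(\<lambda>z. indicat_real (ball 0 1) z *\<^sub>R (deriv g z * cnj z ^ (n-1) * of_real (poisson_kernel (pt i) z))) \<in> borel_measurable lborel"
      by (intro borel_measurable_ball_continuous continuous_intros continuous_on_poisson_kernel) auto
  qed
  have "(LINT z : ball 0 1 | lborel. deriv g z * of_real (poisson_int \<mu> z / pi) * cnj z ^ (n - 1)) =
     (LINT z : ball 0 1 | lborel. (\<Sum>i<3. deriv g z * cnj z ^ (n - 1) * of_real (poisson_kernel (pt i) z)) / of_real pi)"
    by (simp add: poisson_int_eq sum_lessThan_3 field_simps)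
  also have "\<dots> = (\<Sum>i<3. ?I i) / of_real pi"
    using intb by (simp add: sum_lessThan_3 set_integral_add)
  finally have I: "(LINT z : ball 0 1 | lborel. deriv g z * of_real (poisson_int \<mu> z / pi) * cnj z ^ (n - 1)) =
    (\<Sum>i<3. ?I i) / of_real pi" .
  have "cnj \<omega> ^ (i * n) * (pt i ^ n * of_nat n * ?I i / of_real pi) = \<zeta> ^ n * of_nat n * (?I i / of_real pi)" for i
  proof -
    have "cnj \<omega> ^ (i * n) * \<omega> ^ (i * n) = 1" by (simp flip: power_mult_distrib)
    then have "cnj \<omega> ^ (i * n) * pt i ^ n = \<zeta> ^ n"
      by (simp add: pt_def power_mult_distrib flip: power_mult)
    then have "cnj \<omega> ^ (i * n) * pt i ^ n * (of_nat n * ?I i / of_real pi) = \<zeta> ^ n * (of_nat n * ?I i / of_real pi)"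
      by simp
    then show ?thesis by (simp only: mult.assoc times_divide_eq_right)
  qed
  then have 1: "\<zeta> ^ n * of_nat n * (LINT z : ball 0 1 | lborel. deriv g z * of_real (poisson_int \<mu> z / pi) * cnj z ^ (n - 1))
    = (\<Sum>i<3. cnj \<omega> ^ (i * n) * (pt i ^ n * of_nat n * ?I i / of_real pi))"
    unfolding I by (simp only: sum_distrib_left sum_divide_distrib)
  also have "\<dots> = (\<Sum>i<3. cnj \<omega> ^ (i * n) * (of_nat n * bval g i - (\<Sum>m<n. of_nat (n - m) * (taylor_coeff g m * pt i ^ m))))"
    by (intro sum.cong refl) (simp only: boundary_value(2)[OF g] lessThan_iff)
  also have "\<dots> = 3 * of_nat n * E g n - (\<Sum>i<3. \<Sum>m<n. cnj \<omega> ^ (i * n) * (of_nat (n - m) * (taylor_coeff g m * pt i ^ m)))"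
    by (simp add: E_def right_diff_distrib sum_subtractf sum_distrib_left mult_ac)
  also have "(\<Sum>i<3. \<Sum>m<n. cnj \<omega> ^ (i * n) * (of_nat (n - m) * (taylor_coeff g m * pt i ^ m))) =
     (\<Sum>i<3. \<Sum>m<n. cnj \<omega> ^ (i * (n - m)) * (of_nat (n - m) * G g m))"
  proof (intro sum.cong refl)
    fix i m assume "m \<in> {..<n}"
    then have "i * n = i * (n - m) + i * m" by (simp flip: distrib_left)
    then have "cnj \<omega> ^ (i * n) * \<omega> ^ (i * m) = cnj \<omega> ^ (i * (n - m)) * (cnj \<omega> * \<omega>) ^ (i * m)"
      by (simp only: power_add power_mult_distrib mult.assoc)
    then have "cnj \<omega> ^ (i * n) * pt i ^ m = cnj \<omega> ^ (i * (n - m)) * \<zeta> ^ m"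
      by (simp add: pt_def power_mult_distrib flip: power_mult)
    then have "cnj \<omega> ^ (i * n) * pt i ^ m * (of_nat (n - m) * taylor_coeff g m) =
       cnj \<omega> ^ (i * (n - m)) * \<zeta> ^ m * (of_nat (n - m) * taylor_coeff g m)" by simp
    then show "cnj \<omega> ^ (i * n) * (of_nat (n - m) * (taylor_coeff g m * pt i ^ m)) =
       cnj \<omega> ^ (i * (n - m)) * (of_nat (n - m) * G g m)"
      by (simp only: G_def mult_ac)
  qed
  also have "\<dots> = (\<Sum>m<n. if 3 dvd n - m then 3 * of_nat (n - m) * G g m else 0)"
  proof (subst sum.swap, intro sum.cong refl)
    fix m
    show "(\<Sum>i<3. cnj \<omega> ^ (i * (n - m)) * (of_nat (n - m) * G g m)) =
       (if 3 dvd n - m then 3 * of_nat (n - m) * G g m else 0)"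
      unfolding sum_distrib_right[symmetric] sum_\<omega>_powers by simp
  qed
  finally show ?thesis unfolding X_def by simp
qed

text \<open>The derivative series of \<open>pfun b\<close> is dominated on the whole disc by a
  convergent series of constants, so the energy part is integrated termwise against the integrable
  weight. In the Hardy part, the decay of \<open>b\<close> beats the growth of the Taylor
  coefficients of \<open>g\<close>.\<close>

lemma inner_pfun:
  assumes g: "g \<in> Dspace \<mu>" and b: "decaying b"
  shows "(\<lambda>n. cnj (b n) * X g n) sums D_inner \<mu> g (pfun b)"
    and "summable (\<lambda>n. cmod (cnj (b n) * G g n))"
proof -
  have half: "summable (\<lambda>n. cmod (taylor_coeff g n * (1/2) ^ n))"
    by (rule powser_insidea[OF sums_summable[OF taylor_sums[OF g, of "3/4"]]]) simp_all
  obtain C where C: "\<And>n. cmod (b n) \<le> C * (1/2) ^ n" using b by (auto simp: decaying_def)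
  show G_summable: "summable (\<lambda>n. cmod (cnj (b n) * G g n))"
  proof (rule summable_comparison_test'[OF summable_mult[OF half, of C], of 0])
    fix n
    have "cmod (b n) * cmod (taylor_coeff g n) \<le> C * (1/2) ^ n * cmod (taylor_coeff g n)"
      by (intro mult_right_mono C) simp
    then show "norm (cmod (cnj (b n) * G g n)) \<le> C * cmod (taylor_coeff g n * (1/2) ^ n)"
      by (simp add: G_def norm_mult norm_power \<zeta> mult_ac)
  qed
  then have 1: "(\<lambda>n. cnj (b n) * G g n) sums (\<Sum>n. taylor_coeff g n * cnj (taylor_coeff (pfun b) n))"
    using summable_sums[OF summable_norm_cancel[OF G_summable]]
    by (simp add: taylor_coeff_pfun[OF b] G_def mult_ac)
  let ?W = "\<lambda>z. deriv g z * of_real (poisson_int \<mu> z / pi)"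
  let ?t = "\<lambda>n z. of_nat (Suc n) * (b (Suc n) * cnj \<zeta> ^ Suc n) * z ^ n"
  have "(\<lambda>n. LINT z:ball 0 1|lborel. ?W z * cnj (?t n z)) sums (LINT z:ball 0 1|lborel. ?W z * (\<Sum>n. cnj (?t n z)))"
  proof (rule set_integral_suminf_dominated[OF _ _ _ _ decaying_summable_of_nat[OF b]])
    show "set_integrable lborel (ball 0 1) ?W"
      using set_integrable_mult_left[OF deriv_poisson_integrable(1)[OF g], of "1 / of_real pi"]
      by (simp add: field_simps)
    show "cmod (cnj (?t n z)) \<le> of_nat (Suc n) * cmod (b (Suc n))" if "z \<in> ball 0 1" for n z
      unfolding complex_mod_cnj using that by (intro deriv_pfun_term_le) simp
    show "(\<lambda>z. cnj (?t n z)) \<in> borel_measurable lborel" for n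
      unfolding measurable_lborel2 by (intro borel_measurable_continuous_onI continuous_intros)
    show "ball 0 1 \<in> sets lborel" by simp
  qed
  moreover have "(LINT z:ball 0 1|lborel. ?W z * (\<Sum>n. cnj (?t n z))) =
      (LINT z : ball 0 1 | lborel. deriv g z * cnj (deriv (pfun b) z) * complex_of_real (poisson_int \<mu> z / pi))"
  proof (intro set_lebesgue_integral_cong ballI allI impI)
    fix z :: complex assume "z \<in> ball 0 1"
    then have "(\<Sum>n. cnj (?t n z)) = cnj (deriv (pfun b) z)"
      using sums_unique[OF sums_cnj[THEN iffD2, OF deriv_pfun_sums[OF b]], of z] by (simp only: mem_ball_0)
    then show "?W z * (\<Sum>n. cnj (?t n z)) = deriv g z * cnj (deriv (pfun b) z) * complex_of_real (poisson_int \<mu> z / pi)"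
      by (simp only: mult_ac)
  qed auto
  moreover have "(LINT z:ball 0 1|lborel. ?W z * cnj (?t n z)) = cnj (b (Suc n)) * (X g (Suc n) - G g (Suc n))" for n
  proof -
    have "(LINT z:ball 0 1|lborel. ?W z * cnj (?t n z)) =
        (LINT z:ball 0 1|lborel. (of_nat (Suc n) * cnj (b (Suc n)) * \<zeta> ^ Suc n) * (?W z * cnj z ^ (Suc n - 1)))"
    proof (intro set_lebesgue_integral_cong ballI allI impI)
      fix z :: complex
      show "?W z * cnj (?t n z) = (of_nat (Suc n) * cnj (b (Suc n)) * \<zeta> ^ Suc n) * (?W z * cnj z ^ (Suc n - 1))"
        unfolding complex_cnj_mult complex_cnj_power complex_cnj_cnj complex_cnj_of_nat diff_Suc_1 by (simp only: mult_ac)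
    qed simp
    also have "\<dots> = cnj (b (Suc n)) * (\<zeta> ^ Suc n * of_nat (Suc n) * (LINT z:ball 0 1|lborel. ?W z * cnj z ^ (Suc n - 1)))"
      by (subst set_integral_mult_right) (simp only: mult_ac)
    finally show ?thesis unfolding inner_power[OF g] .
  qed
  ultimately have "(\<lambda>n. cnj (b (Suc n)) * (X g (Suc n) - G g (Suc n))) sums
      (LINT z : ball 0 1 | lborel. deriv g z * cnj (deriv (pfun b) z) * complex_of_real (poisson_int \<mu> z / pi))"
    by (simp only:)
  moreover have "X g 0 - G g 0 = 0" by (simp add: X_def)
  ultimately have 2: "(\<lambda>n. cnj (b n) * (X g n - G g n)) sums
      (LINT z : ball 0 1 | lborel. deriv g z * cnj (deriv (pfun b) z) * complex_of_real (poisson_int \<mu> z / pi))"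
    using sums_Suc_iff[of "\<lambda>n. cnj (b n) * (X g n - G g n)"] by simp
  show "(\<lambda>n. cnj (b n) * X g n) sums D_inner \<mu> g (pfun b)"
    unfolding D_inner_def using sums_add[OF 1 2] by (simp add: algebra_simps)
qed

section \<open>The Cauchy dual on the orbit of the constant function\<close>

lemma E_mod: "E g n = E g (n mod 3)"
proof -
  have c3: "cnj \<omega> ^ 3 = 1" using \<omega>(2) by (metis complex_cnj_one complex_cnj_power)
  have "cnj \<omega> ^ (i * n) = cnj \<omega> ^ (i * (n mod 3))" for i
  proof -
    have "i * n = 3 * (i * (n div 3)) + i * (n mod 3)"
      using arg_cong[OF div_mult_mod_eq[of n 3], of "\<lambda>m. i * m"] by (simp only: distrib_left mult_ac)
    then show ?thesis by (simp add: power_add power_mult c3)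
  qed
  then show ?thesis by (simp add: E_def)
qed

lemma bval_pfun:
  assumes b: "decaying b" and i: "i < 3"
  shows "(\<lambda>n. b n * \<omega> ^ (i * n)) sums bval (pfun b) i"
proof -
  have "summable (\<lambda>n. b n * (3/2) ^ n)"
    by (rule summable_norm_cancel[OF decaying_summable[OF b]]) simp
  then have "isCont (\<lambda>x. \<Sum>n. b n * x ^ n) (\<omega> ^ i)"
    by (rule isCont_powser) (simp add: norm_power \<omega>)
  moreover have "(\<lambda>N. of_real ((radius N)\<^sup>2) * \<omega> ^ i) \<longlonglongrightarrow> of_real (1\<^sup>2) * \<omega> ^ i"
    by (intro tendsto_intros radius)
  ultimately have "(\<lambda>N. \<Sum>n. b n * (of_real ((radius N)\<^sup>2) * \<omega> ^ i) ^ n) \<longlonglongrightarrow> (\<Sum>n. b n * (\<omega> ^ i) ^ n)"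
    using isCont_tendsto_compose[of "\<omega> ^ i" "\<lambda>x. \<Sum>n. b n * x ^ n"] by simp
  moreover have "(\<Sum>n. b n * (of_real ((radius N)\<^sup>2) * \<omega> ^ i) ^ n) = pfun b (of_real ((radius N)\<^sup>2) * pt i)" for N
  proof -
    have "(radius N)\<^sup>2 < 1" using radius(1,2)[of N] by (simp add: abs_square_less_1)
    then have "cmod (of_real ((radius N)\<^sup>2) * pt i) < 1" by (simp add: norm_mult norm_power)
    moreover have "cnj \<zeta> * (of_real ((radius N)\<^sup>2) * pt i) = of_real ((radius N)\<^sup>2) * \<omega> ^ i"
      by (simp add: pt_def) 
    ultimately show ?thesis by (simp only: pfun_def if_True)
  qed
  ultimately have "bval (pfun b) i = (\<Sum>n. b n * (\<omega> ^ i) ^ n)"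
    by (simp add: bval_def limI)
  moreover have "summable (\<lambda>n. b n * (\<omega> ^ i) ^ n)"
    by (intro summable_norm_cancel[OF decaying_summable[OF b]]) (simp add: norm_power \<omega>)
  ultimately show ?thesis by (simp add: summable_sums power_mult)
qed

lemma E_pfun:
  assumes b: "decaying b"
  shows "(\<lambda>n. if n mod 3 = k mod 3 then b n else 0) sums E (pfun b) k"
proof -
  have c3: "cnj \<omega> ^ 3 = 1" using \<omega>(2) by (metis complex_cnj_one complex_cnj_power)
  \<comment> \<open>Writing \<open>\<omega>\<close> as the square of \<open>cnj \<omega>\<close>
    merges both exponents into \<open>i * (k + 2 * n)\<close>, so one application of
    \<open>sum_\<omega>_powers\<close> selects the class.\<close>
  have "\<omega> = \<omega> * cnj \<omega> ^ 3" by (simp add: c3)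
  also have "\<dots> = (\<omega> * cnj \<omega>) * cnj \<omega> ^ 2" by (simp only: power2_eq_square power3_eq_cube mult.assoc)
  finally have \<omega>2: "\<omega> = cnj \<omega> ^ 2" by simp
  have "(\<Sum>i<3. cnj \<omega> ^ (i * k) * (b n * \<omega> ^ (i * n))) / 3 = (if n mod 3 = k mod 3 then b n else 0)" for n
  proof -
    have "cnj \<omega> ^ (i * k) * (b n * \<omega> ^ (i * n)) = cnj \<omega> ^ (i * (k + 2 * n)) * b n" for i
    proof -
      have "\<omega> ^ (i * n) = cnj \<omega> ^ (2 * (i * n))" by (subst \<omega>2) (simp only: power_mult)
      then show ?thesis by (simp add: distrib_left power_add mult_ac)
    qed
    then have "(\<Sum>i<3. cnj \<omega> ^ (i * k) * (b n * \<omega> ^ (i * n))) = (if 3 dvd k + 2 * n then 3 else 0) * b n"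
      by (simp only: sum_\<omega>_powers sum_distrib_right[symmetric])
    moreover have "3 dvd k + 2 * n \<longleftrightarrow> n mod 3 = k mod 3" by presburger
    ultimately show ?thesis by simp
  qed
  moreover have "(\<lambda>n. (\<Sum>i<3. cnj \<omega> ^ (i * k) * (b n * \<omega> ^ (i * n))) / 3) sums E (pfun b) k"
    unfolding E_def by (intro sums_divide sums_sum sums_mult bval_pfun b) simp
  ultimately show ?thesis by simp
qed

lemma E_pfun_diff:
  assumes "decaying b" "decaying c" "decaying (\<lambda>n. b n - t * c n)"
  shows "E (pfun (\<lambda>n. b n - t * c n)) k = E (pfun b) k - t * E (pfun c) k"
proof -
  have "(\<lambda>n. (if n mod 3 = k mod 3 then b n else 0) - t * (if n mod 3 = k mod 3 then c n else 0)) sums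
      (E (pfun b) k - t * E (pfun c) k)"
    by (intro sums_diff sums_mult E_pfun assms)
  also have "(\<lambda>n. (if n mod 3 = k mod 3 then b n else 0) - t * (if n mod 3 = k mod 3 then c n else 0)) =
      (\<lambda>n. if n mod 3 = k mod 3 then b n - t * c n else 0)" by auto
  finally show ?thesis using E_pfun[OF assms(3), of k] sums_unique2 by blast
qed

lemma sums_E:
  assumes b: "decaying b"
  shows "(\<lambda>n. cnj (b n) * E g n) sums (\<Sum>k<3. E g k * cnj (E (pfun b) k))"
proof -
  have "(\<lambda>n. \<Sum>k<3. E g k * cnj (if n mod 3 = k mod 3 then b n else 0)) sums (\<Sum>k<3. E g k * cnj (E (pfun b) k))"
    by (intro sums_sum sums_mult sums_cnj[THEN iffD2] E_pfun b)
  moreover have "(\<Sum>k<3. E g k * cnj (if n mod 3 = k mod 3 then b n else 0)) = cnj (b n) * E g n" for n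
  proof -
    have "n mod 3 = 0 \<or> n mod 3 = 1 \<or> n mod 3 = 2" by linarith
    then show ?thesis by (subst E_mod[of g n]) (auto simp: sum_lessThan_3)
  qed
  ultimately show ?thesis by simp
qed

text \<open>The root of the quadratic inside the unit disc; the roots have product 1.\<close>

definition r :: real where "r = (11 - 3 * sqrt 13) / 2"

lemma r: "0 < r" "r < 1/8" "r\<^sup>2 - 11 * r + 1 = 0"
proof -
  have "sqrt 13 < 11/3" by (rule real_less_lsqrt) (auto simp: power2_eq_square)
  then show "0 < r" by (simp add: r_def)
  have "sqrt 13 > 43/12" by (rule real_less_rsqrt) (simp add: power2_eq_square)
  then show "r < 1/8" by (simp add: r_def)
  show "r\<^sup>2 - 11 * r + 1 = 0" by (simp add: r_def power2_eq_square field_simps)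
qed

text \<open>The sum of the geometric series in \<open>r\<close>, and hence the value of
  \<open>E\<close> at the kernel in its own class.\<close>

definition \<kappa> :: real where "\<kappa> = 1 / (1 - r)"

lemma \<kappa>: "\<kappa> > 0" using r by (simp add: \<kappa>_def)

definition ker :: "nat \<Rightarrow> nat \<Rightarrow> complex" where
  "ker j n = (if n mod 3 = j then of_real (r ^ (n div 3)) else 0)"

lemma decaying_ker: "decaying (ker j)"
  unfolding decaying_def
proof (intro exI allI)
  fix n
  \<comment> \<open>Each block of three indices contributes a factor \<open>r < (1/2) ^ 3\<close>;
    the constant 4 pays for a remainder of at most 2.\<close>
  have "r ^ (n div 3) \<le> 4 * (1/2) ^ n"
  proof -
    have "n = 3 * (n div 3) + n mod 3" by simp
    then have "(1/2::real) ^ n = ((1/2) ^ 3) ^ (n div 3) * (1/2) ^ (n mod 3)"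
      by (metis power_add power_mult)
    also have "\<dots> = (1/8) ^ (n div 3) * (1/2) ^ (n mod 3)" by (simp add: power3_eq_cube)
    finally have e: "(1/2::real) ^ n = (1/8) ^ (n div 3) * (1/2) ^ (n mod 3)" .
    have "(1/2::real) ^ (n mod 3) \<ge> (1/2) ^ 2" by (rule power_decreasing) (auto simp: less_Suc_eq_le[symmetric])
    moreover have "r ^ (n div 3) \<le> (1/8) ^ (n div 3)" using r by (intro power_mono) auto
    ultimately have "r ^ (n div 3) * (1/4) \<le> (1/8) ^ (n div 3) * (1/2) ^ (n mod 3)"
      using r by (intro mult_mono) (auto simp: power2_eq_square)
    then show ?thesis unfolding e by simp
  qed
  then show "cmod (ker j n) \<le> 4 * (1/2) ^ n" using r by (simp add: ker_def norm_power)
qed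

lemma ker_at: "j < 3 \<Longrightarrow> ker j (3 * l + j) = of_real r ^ l"
  by (simp add: ker_def)

lemma sums_class:
  assumes j: "j < (3::nat)" and f: "\<And>n. n mod 3 \<noteq> j \<Longrightarrow> f n = (0::complex)"
  shows "(\<lambda>l. f (3 * l + j)) sums c \<longleftrightarrow> f sums c"
proof (rule sums_mono_reindex)
  show "strict_mono (\<lambda>l. 3 * l + j)" by (simp add: strict_mono_def)
  fix n assume n: "n \<notin> range (\<lambda>l. 3 * l + j)"
  have "n mod 3 \<noteq> j"
  proof
    assume "n mod 3 = j"
    then have "n = 3 * (n div 3) + j" by (metis div_mult_mod_eq mult.commute)
    then show False using n by blast
  qed
  then show "f n = 0" by (rule f)
qed

lemma E_ker:
  assumes j: "j < 3" and k: "k < 3"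
  shows "E (pfun (ker j)) k = (if k = j then of_real \<kappa> else 0)"
proof (cases "k = j")
  case True
  have "(\<lambda>l. of_real r ^ l) sums complex_of_real \<kappa>"
    using geometric_sums[of "complex_of_real r"] r by (simp add: \<kappa>_def)
  then have "(\<lambda>l. ker j (3 * l + j)) sums of_real \<kappa>" using j by (simp add: ker_at)
  then have "ker j sums of_real \<kappa>"
    using sums_class[OF j, of "ker j"] by (simp add: ker_def)
  moreover have "(\<lambda>n. if n mod 3 = k mod 3 then ker j n else 0) = ker j"
    using True j by (auto simp: ker_def)
  ultimately show ?thesis using E_pfun[OF decaying_ker, of k j] sums_unique2 True by metis
next
  case False
  then have "(\<lambda>n. if n mod 3 = k mod 3 then ker j n else 0) = (\<lambda>_. 0)"
    using k by (auto simp: ker_def)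
  then show ?thesis using E_pfun[OF decaying_ker, of k j] sums_zero sums_unique2 False by metis
qed

text \<open>Reindexing along one residue class brings \<open>X\<close> into the form required by
  \<open>kernel_series\<close>; the 9 is 3 from the mass points times 3 from the step
  length.\<close>

lemma X_class:
  assumes j: "j < 3"
  shows "X g (3 * l + j) = G g (3 * l + j) + 3 * of_nat (3 * l + j) * E g j -
     (\<Sum>k<l. 9 * of_nat (l - k) * G g (3 * k + j))"
proof -
  have "(\<Sum>m<3 * l + j. if 3 dvd 3 * l + j - m then 3 * of_nat (3 * l + j - m) * G g m else 0) =
    (\<Sum>m\<in>(\<lambda>k. 3 * k + j) ` {..<l}. if 3 dvd 3 * l + j - m then 3 * of_nat (3 * l + j - m) * G g m else 0)"
  proof (rule sum.mono_neutral_right)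
    show "\<forall>m\<in>{..<3 * l + j} - (\<lambda>k. 3 * k + j) ` {..<l}.
      (if 3 dvd 3 * l + j - m then 3 * of_nat (3 * l + j - m) * G g m else 0) = 0"
    proof
      fix m assume m: "m \<in> {..<3 * l + j} - (\<lambda>k. 3 * k + j) ` {..<l}"
      have "\<not> 3 dvd 3 * l + j - m"
      proof
        assume "3 dvd 3 * l + j - m"
        then obtain q where q: "3 * l + j - m = 3 * q" by (auto elim: dvdE)
        then have "m = 3 * (l - q) + j" "l - q < l" using m j by auto
        then show False using m by blast
      qed
      then show "(if 3 dvd 3 * l + j - m then 3 * of_nat (3 * l + j - m) * G g m else 0) = 0" by simp
    qed
  qed auto
  also have "\<dots> = (\<Sum>k<l. 9 * of_nat (l - k) * G g (3 * k + j))"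
  proof (subst sum.reindex)
    show "inj_on (\<lambda>k. 3 * k + j) {..<l}" by (auto simp: inj_on_def)
    have "3 * l + j - (3 * k + j) = 3 * (l - k)" for k by simp
    then show "sum ((\<lambda>m. if 3 dvd 3 * l + j - m then 3 * of_nat (3 * l + j - m) * G g m else 0) \<circ> (\<lambda>k. 3 * k + j)) {..<l} =
      (\<Sum>k<l. 9 * of_nat (l - k) * G g (3 * k + j))"
      by (intro sum.cong) simp_all
  qed
  finally have "(\<Sum>m<3 * l + j. if 3 dvd 3 * l + j - m then 3 * of_nat (3 * l + j - m) * G g m else 0) =
    (\<Sum>k<l. 9 * of_nat (l - k) * G g (3 * k + j))" .
  moreover have "E g (3 * l + j) = E g j"
    using E_mod[of g "3 * l + j"] E_mod[of g j] by simp
  ultimately show ?thesis by (simp only: X_def)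
qed

text \<open>Up to a positive scalar, \<open>pfun (ker j)\<close> represents the functional
  \<open>E g j\<close> on D(\<mu>): by \<open>kernel_series\<close> no Taylor coefficient survives
  in the pairing.\<close>

lemma inner_ker:
  assumes g: "g \<in> Dspace \<mu>" and j: "j < 3"
  shows "D_inner \<mu> g (pfun (ker j)) = (1 + 3 * of_nat j * of_real \<kappa>) * E g j"
proof -
  have 1: "(\<lambda>l. of_real r ^ l * X g (3 * l + j)) sums D_inner \<mu> g (pfun (ker j))"
    using inner_pfun(1)[OF g decaying_ker[of j]] sums_class[OF j, of "\<lambda>n. cnj (ker j n) * X g n"] j
    by (simp add: ker_at) (simp add: ker_def)
  have "summable (\<lambda>n. cnj (ker j n) * G g n)"
    using inner_pfun(2)[OF g decaying_ker[of j]] by (rule summable_norm_cancel)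
  then have "(\<lambda>n. cnj (ker j n) * G g n) sums (\<Sum>n. cnj (ker j n) * G g n)" by (rule summable_sums)
  then have "(\<lambda>l. of_real r ^ l * G g (3 * l + j)) sums (\<Sum>n. cnj (ker j n) * G g n)"
    using sums_class[OF j, of "\<lambda>n. cnj (ker j n) * G g n"] j
    by (simp add: ker_at) (simp add: ker_def)
  then have "summable (\<lambda>l. of_real r ^ l * G g (3 * l + j))" by (rule sums_summable)
  then have "D_inner \<mu> g (pfun (ker j)) = (1 + 3 * of_nat j / (1 - of_real r)) * E g j"
    using r 1[unfolded X_class[OF j]] by (intro kernel_series[of r]) auto
  then show ?thesis by (simp add: \<kappa>_def)
qed

text \<open>Conjugating the Hardy part requires the convergence of its series, which
  \<open>inner_pfun\<close> provides when one argument is a decaying series.\<close>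

lemma D_inner_swap:
  assumes \<phi>: "\<phi> \<in> Dspace \<mu>" and b: "decaying b"
  shows "D_inner \<mu> (pfun b) \<phi> = cnj (D_inner \<mu> \<phi> (pfun b))"
proof -
  have "(\<lambda>n. taylor_coeff \<phi> n * cnj (taylor_coeff (pfun b) n)) sums (\<Sum>n. taylor_coeff \<phi> n * cnj (taylor_coeff (pfun b) n))"
    using summable_sums[OF summable_norm_cancel[OF inner_pfun(2)[OF \<phi> b]]]
    by (simp add: taylor_coeff_pfun[OF b] G_def mult_ac)
  from sums_unique[OF sums_cnj[THEN iffD2, OF this]]
  have 1: "(\<Sum>n. taylor_coeff (pfun b) n * cnj (taylor_coeff \<phi> n)) = cnj (\<Sum>n. taylor_coeff \<phi> n * cnj (taylor_coeff (pfun b) n))"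
    by (simp add: mult_ac)
  have 2: "(LINT z : ball 0 1 | lborel. deriv (pfun b) z * cnj (deriv \<phi> z) * complex_of_real (poisson_int \<mu> z / pi)) =
    cnj (LINT z : ball 0 1 | lborel. deriv \<phi> z * cnj (deriv (pfun b) z) * complex_of_real (poisson_int \<mu> z / pi))"
    unfolding set_lebesgue_integral_def Bochner_Integration.integral_cnj[symmetric]
    by (intro Bochner_Integration.integral_cong) (auto simp: indicator_def mult_ac)
  show ?thesis unfolding D_inner_def 1 2 by simp
qed

lemma decaying_single: "decaying (\<lambda>m. if m = n then 1 else 0)"
  unfolding decaying_def by (rule exI[of _ "2 ^ n"]) (auto simp flip: power_mult_distrib)

text \<open>Testing against the kernels recovers the boundary values, and then testing against monomials recovers the
  Taylor coefficients one by one. This avoids the density of polynomials in \<open>D(\<mu>)\<close>.\<close>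

lemma pfun_eqI:
  assumes \<phi>: "\<phi> \<in> Dspace \<mu>" and b: "decaying b"
    and eq: "\<And>\<beta>. decaying \<beta> \<Longrightarrow> D_inner \<mu> \<phi> (pfun \<beta>) = D_inner \<mu> (pfun b) (pfun \<beta>)"
  shows "\<phi> = pfun b"
proof -
  have pb: "pfun b \<in> Dspace \<mu>" using b by (rule pfun_in_Dspace)
  have E: "E \<phi> n = E (pfun b) n" for n
  proof -
    define j where "j = n mod 3"
    have j: "j < 3" by (simp add: j_def)
    have "0 < 1 + 3 * real j * \<kappa>" using \<kappa> by (simp add: add_pos_nonneg)
    then have "complex_of_real (1 + 3 * real j * \<kappa>) \<noteq> 0" by (simp only: of_real_eq_0_iff)
    then have "E \<phi> j = E (pfun b) j"
      using eq[OF decaying_ker[of j]] unfolding inner_ker[OF \<phi> j] inner_ker[OF pb j] by simp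
    then show ?thesis unfolding j_def E_mod[symmetric] .
  qed
  have X: "X \<phi> n = X (pfun b) n" for n
  proof -
    have "D_inner \<mu> g (pfun (\<lambda>m. if m = n then 1 else 0)) = X g n" if g: "g \<in> Dspace \<mu>" for g
    proof -
      have "(\<lambda>m. cnj (if m = n then 1 else 0) * X g m) = (\<lambda>m. if m = n then X g m else 0)" by auto
      then show ?thesis
        using inner_pfun(1)[OF g decaying_single[of n]] sums_single[of n "X g"] sums_unique2 by metis
    qed
    then show ?thesis using eq[OF decaying_single[of n]] \<phi> pb by simp
  qed
  have G: "G \<phi> n = G (pfun b) n" for n
  proof (induction n rule: less_induct)
    case (less n)
    have "(\<Sum>m<n. if 3 dvd n - m then 3 * of_nat (n - m) * G \<phi> m else 0) =
      (\<Sum>m<n. if 3 dvd n - m then 3 * of_nat (n - m) * G (pfun b) m else 0)"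
      using less by (intro sum.cong) auto
    then show ?case using X[of n] E[of n] by (simp add: X_def)
  qed
  have "\<zeta> \<noteq> 0" using \<zeta> by auto
  then have t: "taylor_coeff \<phi> n = taylor_coeff (pfun b) n" for n using G[of n] by (simp add: G_def)
  show ?thesis
  proof
    fix z
    show "\<phi> z = pfun b z"
    proof (cases "cmod z < 1")
      case True
      then show ?thesis
        using taylor_sums[OF \<phi> True] taylor_sums[OF pb True] sums_unique2 by (simp only: t)
    next
      case False
      then show ?thesis using \<phi> by (simp add: Dspace_def pfun_def)
    qed
  qed
qed

text \<open>The factor \<open>\<zeta>\<close> appears because \<open>pfun\<close> expands in powers
  of \<open>cnj \<zeta> * z\<close>, and \<open>z = \<zeta> * (cnj \<zeta> * z)\<close>.\<close>

definition shift :: "(nat \<Rightarrow> complex) \<Rightarrow> nat \<Rightarrow> complex" where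
  "shift b n = (case n of 0 \<Rightarrow> 0 | Suc m \<Rightarrow> \<zeta> * b m)"

lemma shift_simps [simp]: "shift b 0 = 0" "shift b (Suc n) = \<zeta> * b n"
  by (simp_all add: shift_def)

lemma decaying_shift: assumes "decaying b" shows "decaying (shift b)"
proof -
  obtain C where C: "\<And>n. cmod (b n) \<le> C * (1/2) ^ n" using assms by (auto simp: decaying_def)
  have C0: "0 \<le> C" using C[of 0] norm_ge_zero[of "b 0"] by (simp del: norm_ge_zero)
  have "cmod (shift b n) \<le> (2 * C) * (1/2) ^ n" for n
    using C C0 by (cases n) (auto simp: shift_def norm_mult \<zeta>)
  then show ?thesis by (auto simp: decaying_def)
qed

lemma decaying_diff: assumes "decaying b" "decaying c" shows "decaying (\<lambda>n. b n - t * c n)"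
proof -
  obtain C where C: "\<And>n. cmod (b n) \<le> C * (1/2) ^ n" using assms by (auto simp: decaying_def)
  obtain D where D: "\<And>n. cmod (c n) \<le> D * (1/2) ^ n" using assms by (auto simp: decaying_def)
  have "cmod (b n - t * c n) \<le> (C + cmod t * D) * (1/2) ^ n" for n
  proof -
    have "cmod (b n - t * c n) \<le> cmod (b n) + cmod t * cmod (c n)"
      by (metis norm_mult norm_triangle_ineq4)
    also have "\<dots> \<le> C * (1/2) ^ n + cmod t * (D * (1/2) ^ n)"
      by (intro add_mono mult_left_mono C D) simp
    finally show ?thesis by (simp add: algebra_simps)
  qed
  then show ?thesis by (auto simp: decaying_def)
qed

lemma Mz_pfun:
  assumes b: "decaying b"
  shows "Mz (pfun b) = pfun (shift b)"
proof
  fix z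
  show "Mz (pfun b) z = pfun (shift b) z"
  proof (cases "cmod z < 1")
    case True
    have "(\<lambda>n. (shift b (Suc n) * cnj \<zeta> ^ Suc n) * z ^ Suc n) sums (z * pfun b z)"
    proof -
      have "(shift b (Suc n) * cnj \<zeta> ^ Suc n) * z ^ Suc n = (cnj \<zeta> * \<zeta>) * (z * ((b n * cnj \<zeta> ^ n) * z ^ n))" for n
        by (simp add: shift_def del: \<zeta>_cnj)
      then have e: "(shift b (Suc n) * cnj \<zeta> ^ Suc n) * z ^ Suc n = z * ((b n * cnj \<zeta> ^ n) * z ^ n)" for n
        by (simp only: \<zeta>_cnj mult_1_left)
      show ?thesis unfolding e by (rule sums_mult[OF pfun_sums[OF b True]])
    qed
    then have "(\<lambda>n. (shift b n * cnj \<zeta> ^ n) * z ^ n) sums (z * pfun b z)"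
      using sums_Suc_iff[of "\<lambda>n. (shift b n * cnj \<zeta> ^ n) * z ^ n"] by (simp add: shift_def)
    then show ?thesis using pfun_sums[OF decaying_shift[OF b] True] sums_unique2 unfolding Mz_def by blast
  qed (simp add: Mz_def pfun_def)
qed

lemma G_pfun: "decaying b \<Longrightarrow> G (pfun b) n = b n"
  by (simp add: G_def taylor_coeff_pfun mult.assoc)

lemma E_shift:
  assumes b: "decaying b"
  shows "E (pfun (shift b)) (Suc k) = \<zeta> * E (pfun b) k"
proof -
  have m: "Suc n mod 3 = Suc k mod 3 \<longleftrightarrow> n mod 3 = k mod 3" for n
    using mod_less_divisor[of 3 n] mod_less_divisor[of 3 k] by (auto simp: mod_Suc)
  have "(if Suc n mod 3 = Suc k mod 3 then shift b (Suc n) else 0) = \<zeta> * (if n mod 3 = k mod 3 then b n else 0)" for n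
    unfolding m by (simp add: shift_def)
  then have "(\<lambda>n. if Suc n mod 3 = Suc k mod 3 then shift b (Suc n) else 0) sums (\<zeta> * E (pfun b) k)"
    using sums_mult[OF E_pfun[OF b, of k], of \<zeta>] by (simp only:)
  then have "(\<lambda>n. if n mod 3 = Suc k mod 3 then shift b n else 0) sums (\<zeta> * E (pfun b) k)"
    using sums_Suc_iff[of "\<lambda>n. if n mod 3 = Suc k mod 3 then shift b n else 0"] by (simp split: if_splits)
  then show ?thesis using E_pfun[OF decaying_shift[OF b], of "Suc k"] sums_unique2 by blast
qed

text \<open>The shift preserves all differences \<open>n - m\<close>; only the factor
  \<open>of_nat n\<close> in front of \<open>E\<close> grows by one. The surplus
  \<open>3 * E\<close> is the whole effect of T^*T - I.\<close>

lemma X_shift: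
  assumes b: "decaying b"
  shows "X (pfun (shift b)) (Suc n) = \<zeta> * (X (pfun b) n + 3 * E (pfun b) n)"
proof -
  have "(\<Sum>m<Suc n. if 3 dvd Suc n - m then 3 * of_nat (Suc n - m) * shift b m else 0) =
      \<zeta> * (\<Sum>m<n. if 3 dvd n - m then 3 * of_nat (n - m) * b m else 0)"
    unfolding sum.lessThan_Suc_shift sum_distrib_left by (simp, intro sum.cong) auto
  then show ?thesis
    unfolding X_def G_pfun[OF decaying_shift[OF b]] G_pfun[OF b] E_shift[OF b]
    by (simp add: shift_def algebra_simps)
qed

lemma inner_shift:
  assumes \<beta>: "decaying \<beta>" and b: "decaying b"
  shows "D_inner \<mu> (pfun (shift \<beta>)) (pfun (shift b)) =
    D_inner \<mu> (pfun \<beta>) (pfun b) + 3 * (\<Sum>k<3. E (pfun \<beta>) k * cnj (E (pfun b) k))"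
proof -
  have "(\<lambda>n. cnj (b n) * X (pfun \<beta>) n + 3 * (cnj (b n) * E (pfun \<beta>) n)) sums
    (D_inner \<mu> (pfun \<beta>) (pfun b) + 3 * (\<Sum>k<3. E (pfun \<beta>) k * cnj (E (pfun b) k)))"
    by (intro sums_add sums_mult inner_pfun(1) pfun_in_Dspace sums_E \<beta> b)
  also have "(\<lambda>n. cnj (b n) * X (pfun \<beta>) n + 3 * (cnj (b n) * E (pfun \<beta>) n)) =
      (\<lambda>n. cnj (shift b (Suc n)) * X (pfun (shift \<beta>)) (Suc n))"
  proof
    fix n
    have "cnj (shift b (Suc n)) * X (pfun (shift \<beta>)) (Suc n) =
        (cnj \<zeta> * \<zeta>) * (cnj (b n) * (X (pfun \<beta>) n + 3 * E (pfun \<beta>) n))"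
      unfolding X_shift[OF \<beta>] by (simp add: shift_def del: \<zeta>_cnj)
    then show "cnj (b n) * X (pfun \<beta>) n + 3 * (cnj (b n) * E (pfun \<beta>) n) =
        cnj (shift b (Suc n)) * X (pfun (shift \<beta>)) (Suc n)"
      by (simp add: algebra_simps)
  qed
  finally have "(\<lambda>n. cnj (shift b n) * X (pfun (shift \<beta>)) n) sums
     (D_inner \<mu> (pfun \<beta>) (pfun b) + 3 * (\<Sum>k<3. E (pfun \<beta>) k * cnj (E (pfun b) k)))"
    using sums_Suc_iff[of "\<lambda>n. cnj (shift b n) * X (pfun (shift \<beta>)) n"] by (simp add: shift_def)
  then show ?thesis
    using inner_pfun(1)[OF pfun_in_Dspace[OF decaying_shift[OF \<beta>]] decaying_shift[OF b]] sums_unique2 by blast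
qed

lemma inner_diff:
  assumes g: "g \<in> Dspace \<mu>" and b: "decaying b" "decaying c"
  shows "D_inner \<mu> g (pfun (\<lambda>n. b n - t * c n)) = D_inner \<mu> g (pfun b) - cnj t * D_inner \<mu> g (pfun c)"
proof -
  have "(\<lambda>n. cnj (b n) * X g n - cnj t * (cnj (c n) * X g n)) sums
      (D_inner \<mu> g (pfun b) - cnj t * D_inner \<mu> g (pfun c))"
    by (intro sums_diff sums_mult inner_pfun g b)
  then show ?thesis
    using sums_unique2[OF inner_pfun(1)[OF g decaying_diff[OF b, of t]]] by (simp add: algebra_simps)
qed


text \<open>On sequences concentrated in the class \<open>j\<close>, this is the inverse of \<open>T\<^sup>*T\<close>.\<close>

definition damp :: "nat \<Rightarrow> (nat \<Rightarrow> complex) \<Rightarrow> nat \<Rightarrow> complex" where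
  "damp j b = (\<lambda>n. b n - 3 * E (pfun b) j / of_real (1 + 3 * (real j + 1) * \<kappa>) * ker j n)"

lemma decaying_damp: "decaying b \<Longrightarrow> decaying (damp j b)"
  unfolding damp_def by (intro decaying_diff decaying_ker)

text \<open>A condition on boundary values rather than on the support of \<open>b\<close>, since the
  correction term in \<open>inner_shift\<close> sees \<open>b\<close> only through
  \<open>E\<close>.\<close>

definition concentrated :: "nat \<Rightarrow> (nat \<Rightarrow> complex) \<Rightarrow> bool" where
  "concentrated j b \<longleftrightarrow> j < 3 \<and> (\<forall>k<3. k \<noteq> j \<longrightarrow> E (pfun b) k = 0)"

text \<open>Let \<open>c = 1 + 3 * j * \<kappa>\<close> be the scalar of \<open>inner_ker\<close>.
  On class \<open>j\<close>, T^*T adds \<open>3 * E / c\<close> times the kernel. Solving this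
  rank-one equation gives the coefficient \<open>3 * E / (c + 3 * \<kappa>)\<close> in
  \<open>damp\<close>, and the inverse scales \<open>E\<close> by
  \<open>c / (c + 3 * \<kappa>)\<close>.\<close>

definition ratio :: "nat \<Rightarrow> real" where
  "ratio j = (1 + 3 * real j * \<kappa>) / (1 + 3 * (real j + 1) * \<kappa>)"

lemma denominators: "0 < 1 + 3 * real j * \<kappa>" "0 < 1 + 3 * (real j + 1) * \<kappa>"
  using \<kappa> by (auto intro!: add_pos_nonneg)

lemma E_damp:
  assumes b: "decaying b" and j: "concentrated j b" and k: "k < 3"
  shows "E (pfun (damp j b)) k = (if k = j then of_real (ratio j) * E (pfun b) j else 0)"
proof -
  define t where "t = 3 * E (pfun b) j / of_real (1 + 3 * (real j + 1) * \<kappa>)"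
  have j3: "j < 3" using j by (simp add: concentrated_def)
  have d: "damp j b = (\<lambda>n. b n - t * ker j n)" by (simp add: damp_def t_def)
  have e: "E (pfun (damp j b)) k = E (pfun b) k - t * E (pfun (ker j)) k"
    using decaying_damp[OF b, of j] unfolding d by (intro E_pfun_diff b decaying_ker)
  show ?thesis
  proof (cases "k = j")
    case True
    have "of_real (1 + 3 * (real j + 1) * \<kappa>) \<noteq> (0::complex)"
      using denominators(2)[of j] by (simp only: of_real_eq_0_iff)
    then have "E (pfun b) j - t * of_real \<kappa> =
      (of_real (1 + 3 * (real j + 1) * \<kappa>) - of_real (3 * \<kappa>)) / of_real (1 + 3 * (real j + 1) * \<kappa>) * E (pfun b) j"
      unfolding t_def by (simp add: diff_divide_distrib left_diff_distrib)
    also have "(of_real (1 + 3 * (real j + 1) * \<kappa>) - of_real (3 * \<kappa>)) = complex_of_real (1 + 3 * real j * \<kappa>)"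
      unfolding of_real_diff[symmetric] by (simp add: algebra_simps)
    finally show ?thesis using True e E_ker[OF j3 k] by (simp add: ratio_def)
  next
    case False
    then show ?thesis using e E_ker[OF j3 k] j k by (simp add: concentrated_def)
  qed
qed

lemma inner_damp:
  assumes g: "g \<in> Dspace \<mu>" and b: "decaying b" and j: "j < 3"
  shows "D_inner \<mu> g (pfun (damp j b)) =
    D_inner \<mu> g (pfun b) - 3 * of_real (ratio j) * E g j * cnj (E (pfun b) j)"
proof -
  have "D_inner \<mu> g (pfun (damp j b)) = D_inner \<mu> g (pfun b) -
      cnj (3 * E (pfun b) j / of_real (1 + 3 * (real j + 1) * \<kappa>)) * ((1 + 3 * of_nat j * of_real \<kappa>) * E g j)"
    unfolding damp_def inner_diff[OF g b decaying_ker] inner_ker[OF g j] ..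
  also have "cnj (3 * E (pfun b) j / of_real (1 + 3 * (real j + 1) * \<kappa>)) * ((1 + 3 * of_nat j * of_real \<kappa>) * E g j) =
    3 * of_real (ratio j) * E g j * cnj (E (pfun b) j)"
    by (simp add: ratio_def mult_ac)
  finally show ?thesis .
qed

text \<open>The term added by \<open>inner_shift\<close> equals the term removed by
  \<open>inner_damp\<close>. This is the weak form of T^*T applied to \<open>damp j b\<close> giving
  back \<open>b\<close>.\<close>

lemma inner_shift_damp:
  assumes \<beta>: "decaying \<beta>" and b: "decaying b" and j: "concentrated j b"
  shows "D_inner \<mu> (pfun (shift \<beta>)) (pfun (shift (damp j b))) = D_inner \<mu> (pfun \<beta>) (pfun b)"
proof -
  have j3: "j < 3" using j by (simp add: concentrated_def)
  have "(\<Sum>k<3. E (pfun \<beta>) k * cnj (E (pfun (damp j b)) k)) =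
      (\<Sum>k<3. if k = j then of_real (ratio j) * E (pfun \<beta>) j * cnj (E (pfun b) j) else 0)"
    by (intro sum.cong refl) (simp add: E_damp[OF b j])
  also have "\<dots> = of_real (ratio j) * E (pfun \<beta>) j * cnj (E (pfun b) j)"
    using j3 by simp
  finally show ?thesis
    unfolding inner_shift[OF \<beta> decaying_damp[OF b]] inner_damp[OF pfun_in_Dspace[OF \<beta>] b j3] by simp
qed

text \<open>The squared norm of T'f is the inner product of the inverse of T^*T at f with f, and
  \<open>inner_damp\<close> evaluates it.\<close>

lemma inner_self_step:
  assumes b: "decaying b" and j: "concentrated j b"
  shows "Re (D_inner \<mu> (pfun (shift (damp j b))) (pfun (shift (damp j b)))) =
    Re (D_inner \<mu> (pfun b) (pfun b)) - 3 * ratio j * (cmod (E (pfun b) j))\<^sup>2"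
proof -
  have j3: "j < 3" using j by (simp add: concentrated_def)
  have pb: "pfun b \<in> Dspace \<mu>" by (rule pfun_in_Dspace[OF b])
  have "D_inner \<mu> (pfun (shift (damp j b))) (pfun (shift (damp j b))) = D_inner \<mu> (pfun (damp j b)) (pfun b)"
    by (rule inner_shift_damp[OF decaying_damp[OF b] b j])
  also have "\<dots> = cnj (D_inner \<mu> (pfun b) (pfun (damp j b)))"
    by (rule D_inner_swap[OF pb decaying_damp[OF b]])
  also have "\<dots> = cnj (D_inner \<mu> (pfun b) (pfun b) - of_real (3 * ratio j * (cmod (E (pfun b) j))\<^sup>2))"
    unfolding inner_damp[OF pb b j3] by (simp add: complex_norm_square mult_ac del: of_real_power)
  finally show ?thesis by simp
qed

lemma concentrated_step:
  assumes b: "decaying b" and j: "concentrated j b"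
  shows "concentrated (Suc j mod 3) (shift (damp j b))"
    and "cmod (E (pfun (shift (damp j b))) (Suc j mod 3)) = ratio j * cmod (E (pfun b) j)"
proof -
  have j3: "j < 3" using j by (simp add: concentrated_def)
  have s: "E (pfun (shift (damp j b))) (Suc k mod 3) = \<zeta> * E (pfun (damp j b)) k" for k
    using E_shift[OF decaying_damp[OF b]] E_mod by metis
  have "E (pfun (shift (damp j b))) k = 0" if k: "k < 3" "k \<noteq> Suc j mod 3" for k
  proof -
    \<comment> \<open>The cyclic predecessor of \<open>k\<close>, since multiplication by
      \<open>z\<close> moves each class to the next.\<close>
    define k' where "k' = (k + 2) mod 3"
    have k': "k' < 3" "Suc k' mod 3 = k" "k' \<noteq> j"
      using k j3 by (auto simp: k'_def mod_Suc_eq)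
    then show ?thesis using s[of k'] E_damp[OF b j k'(1)] by simp
  qed
  then show "concentrated (Suc j mod 3) (shift (damp j b))" by (simp add: concentrated_def)
  have "0 \<le> ratio j" using denominators[of j] by (simp add: ratio_def)
  then show "cmod (E (pfun (shift (damp j b))) (Suc j mod 3)) = ratio j * cmod (E (pfun b) j)"
    unfolding s E_damp[OF b j j3] by (simp add: norm_mult \<zeta>)
qed

text \<open>Coefficients of the iterates of T' at the constant 1. The iterate with index
  \<open>n\<close> is concentrated in class \<open>n mod 3\<close>, which is why that class is
  damped.\<close>

fun orbit :: "nat \<Rightarrow> nat \<Rightarrow> complex" where
  "orbit 0 = (\<lambda>m. if m = 0 then 1 else 0)"
| "orbit (Suc n) = shift (damp (n mod 3) (orbit n))"

lemma orbit: "decaying (orbit n)" "concentrated (n mod 3) (orbit n)"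
proof (induction n)
  case 0
  have "(\<lambda>n. if n mod 3 = k mod 3 then (if n = 0 then 1 else 0) else 0) sums (0::complex)" if "k < 3" "k \<noteq> 0" for k :: nat
  proof -
    have "(\<lambda>n. if n mod 3 = k mod 3 then (if n = 0 then 1 else 0) else 0) = (\<lambda>_. 0::complex)" using that by auto
    then show ?thesis by simp
  qed
  then have "E (pfun (\<lambda>m. if m = 0 then 1 else 0)) k = 0" if "k < 3" "k \<noteq> 0" for k
    using E_pfun[OF decaying_single[of 0], of k] that sums_unique2 by blast
  then show "decaying (orbit 0)" "concentrated (0 mod 3) (orbit 0)"
    using decaying_single[of 0] by (simp_all add: concentrated_def)
next
  case (Suc n)
  show "decaying (orbit (Suc n))" using Suc by (simp add: decaying_shift decaying_damp)
  show "concentrated (Suc n mod 3) (orbit (Suc n))"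
    using concentrated_step(1)[OF Suc] by (simp add: mod_Suc_eq)
qed

section \<open>Amplitudes, norms and drops along the orbit\<close>

definition amp :: "nat \<Rightarrow> real" where "amp n = cmod (E (pfun (orbit n)) (n mod 3))"

lemma amp_0: "amp 0 = 1"
proof -
  have "(\<lambda>n::nat. if n mod 3 = 0 mod 3 then (if n = 0 then 1 else 0) else 0) = (\<lambda>n. if n = 0 then 1 else (0::complex))" by auto
  then have "(\<lambda>n. if n = 0 then 1 else (0::complex)) sums E (pfun (\<lambda>m. if m = 0 then 1 else 0)) 0"
    using E_pfun[OF decaying_single[of 0], of 0] by simp
  moreover have "(\<lambda>n. if n = 0 then 1 else (0::complex)) sums 1" using sums_single[of 0 "\<lambda>_. 1::complex"] by simp
  ultimately have "E (pfun (\<lambda>m. if m = 0 then 1 else 0)) 0 = 1" by (rule sums_unique2)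
  then show ?thesis by (simp add: amp_def)
qed

lemma amp_Suc: "amp (Suc n) = ratio (n mod 3) * amp n"
  using concentrated_step(2)[OF orbit] by (simp add: amp_def mod_Suc_eq)

definition nrm :: "nat \<Rightarrow> real" where "nrm n = Re (D_inner \<mu> (pfun (orbit n)) (pfun (orbit n)))"

lemma nrm_Suc: "nrm n - nrm (Suc n) = 3 * ratio (n mod 3) * (amp n)\<^sup>2"
  using inner_self_step[OF orbit] by (simp add: nrm_def amp_def)

text \<open>All drops are nonnegative; this supplies the orbit bound for
  \<open>sq_iter_drop_log_convex\<close>.\<close>

lemma nrm_le: "nrm n \<le> nrm 0"
proof (induction n)
  case (Suc n)
  have "0 \<le> ratio (n mod 3)" using denominators[of "n mod 3"] by (simp add: ratio_def)
  then have "0 \<le> 3 * ratio (n mod 3) * (amp n)\<^sup>2" by simp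
  then show ?case using nrm_Suc[of n] Suc by linarith
qed simp

text \<open>The amplitudes of the orbit at times 1, 2, 3 are \<open>1 / x\<close>, \<open>1 / y\<close>, \<open>1 / z\<close>, and the claim reduces to \<open>y < x\<^sup>2\<close>.\<close>

lemma drops_not_log_convex:
  "(nrm 2 - nrm 3)\<^sup>2 > (nrm 1 - nrm 2) * (nrm 3 - nrm 4)"
proof -
  define x where "x = 1 + 3 * \<kappa>"
  define y where "y = 1 + 6 * \<kappa>"
  define z where "z = 1 + 9 * \<kappa>"
  have pos: "x > 0" "y > 0" "z > 0" using \<kappa> by (auto simp: x_def y_def z_def)
  have ratio: "ratio 0 = 1 / x" "ratio 1 = x / y" "ratio 2 = y / z"
    by (simp_all add: ratio_def x_def y_def z_def)
  have a1: "amp 1 = 1 / x" using amp_Suc[of 0] amp_0 ratio by simp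
  have a2: "amp 2 = 1 / y" using amp_Suc[of 1] a1 ratio pos by (simp add: numeral_2_eq_2)
  have a3: "amp 3 = 1 / z" using amp_Suc[of 2] a2 ratio pos by simp
  have d1: "nrm 1 - nrm 2 = 3 * (x / y) * (1 / x)\<^sup>2" using nrm_Suc[of 1] a1 ratio by (simp add: numeral_2_eq_2)
  have d2: "nrm 2 - nrm 3 = 3 * (y / z) * (1 / y)\<^sup>2" using nrm_Suc[of 2] a2 ratio by simp
  \<comment> \<open>At time 3 the orbit is back in class 0, so the small factor
    \<open>ratio 0\<close> recurs.\<close>
  have d3: "nrm 3 - nrm 4 = 3 * (1 / x) * (1 / z)\<^sup>2" using nrm_Suc[of 3] a3 ratio by simp
  \<comment> \<open>The difference is \<open>9 * \<kappa>\<^sup>2\<close>.\<close>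
  have "y < x\<^sup>2" using \<kappa> by (simp add: x_def y_def power2_eq_square algebra_simps)
  then have "1 / x\<^sup>2 < 1 / y" using pos by (simp add: frac_less2)
  then have "9 / (y * z\<^sup>2) * (1 / x\<^sup>2) < 9 / (y * z\<^sup>2) * (1 / y)"
    using pos by (intro mult_strict_left_mono) auto
  moreover have "(3 * (y / z) * (1 / y)\<^sup>2)\<^sup>2 = 9 / (y * z\<^sup>2) * (1 / y)"
    using pos by (simp add: field_simps power2_eq_square)
  moreover have "3 * (x / y) * (1 / x)\<^sup>2 * (3 * (1 / x) * (1 / z)\<^sup>2) = 9 / (y * z\<^sup>2) * (1 / x\<^sup>2)"
    using pos by (simp add: field_simps power2_eq_square)
  ultimately show ?thesis unfolding d1 d2 d3 by simp
qed

text \<open>It suffices that \<open>A (Mz (pfun (damp j b)))\<close> is \<open>pfun b\<close>,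
  because \<open>B\<close> undoes the left side. That element is described only by its inner
  products, and \<open>pfun_eqI\<close> identifies it from those with decaying series.\<close>

lemma cauchy_dual_pfun:
  assumes A: "\<forall>g\<in>Dspace \<mu>. A g \<in> Dspace \<mu>"
    and adj: "\<forall>f\<in>Dspace \<mu>. \<forall>g\<in>Dspace \<mu>. D_inner \<mu> (Mz f) g = D_inner \<mu> f (A g)"
    and inv: "\<forall>f\<in>Dspace \<mu>. B (A (Mz f)) = f"
    and b: "decaying b" and j: "concentrated j b"
  shows "Mz (B (pfun b)) = pfun (shift (damp j b))"
proof -
  have nd: "decaying (damp j b)" and pd: "pfun (damp j b) \<in> Dspace \<mu>" and ps: "pfun (shift (damp j b)) \<in> Dspace \<mu>"
    using b by (auto intro!: decaying_damp decaying_shift pfun_in_Dspace)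
  define \<phi> where "\<phi> = A (Mz (pfun (damp j b)))"
  have \<phi>: "\<phi> \<in> Dspace \<mu>" using A ps by (simp add: \<phi>_def Mz_pfun[OF nd])
  have "\<phi> = pfun b"
  proof (rule pfun_eqI[OF \<phi> b])
    fix \<beta> assume \<beta>: "decaying \<beta>"
    have p\<beta>: "pfun \<beta> \<in> Dspace \<mu>" by (rule pfun_in_Dspace[OF \<beta>])
    have "D_inner \<mu> (pfun \<beta>) \<phi> = D_inner \<mu> (pfun \<beta>) (pfun b)"
      using adj p\<beta> ps inner_shift_damp[OF \<beta> b j] unfolding \<phi>_def
      by (metis Mz_pfun[OF \<beta>] Mz_pfun[OF nd])
    then show "D_inner \<mu> \<phi> (pfun \<beta>) = D_inner \<mu> (pfun b) (pfun \<beta>)"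
      using D_inner_swap[OF \<phi> \<beta>] D_inner_swap[OF p\<beta> b] by (metis complex_cnj_cnj)
  qed
  then have "B (pfun b) = pfun (damp j b)" using inv pd by (metis \<phi>_def)
  then show ?thesis by (simp add: Mz_pfun[OF nd])
qed

end

theorem theorem1p1:
  fixes \<zeta>1 :: complex
    and A B :: "(complex \<Rightarrow> complex) \<Rightarrow> (complex \<Rightarrow> complex)"
    and K :: "'k set" and add :: "'k \<Rightarrow> 'k \<Rightarrow> 'k" and sm :: "complex \<Rightarrow> 'k \<Rightarrow> 'k"
    and zero :: 'k and ip :: "'k \<Rightarrow> 'k \<Rightarrow> complex"
  assumes "cmod \<zeta>1 = 1"
    and "\<mu> = three_point_measure \<zeta>1"
    \<comment> \<open>A is the adjoint of M_z on D(mu)\<close>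
    and "\<forall>g\<in>Dspace \<mu>. A g \<in> Dspace \<mu>"
    and "\<forall>f\<in>Dspace \<mu>. \<forall>g\<in>Dspace \<mu>. D_inner \<mu> (Mz f) g = D_inner \<mu> f (A g)"
    \<comment> \<open>B is the inverse of M_z^* M_z on D(mu)\<close>
    and "\<forall>g\<in>Dspace \<mu>. B g \<in> Dspace \<mu> \<and> A (Mz (B g)) = g"
    and "\<forall>f\<in>Dspace \<mu>. B (A (Mz f)) = f"
    \<comment> \<open>K is an arbitrary complex Hilbert space\<close>
    and "chilbert K add sm zero ip"
  shows "\<not> has_normal_extension_in K add sm ip \<mu> (\<lambda>f. Mz (B f))"
proof
  interpret equispaced \<zeta>1 using assms(1) by unfold_locales
  assume "has_normal_extension_in K add sm ip \<mu> (\<lambda>f. Mz (B f))"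
  then obtain J S where J: "\<forall>f\<in>Dspace \<mu>. J f \<in> K"
    and ip: "\<forall>f\<in>Dspace \<mu>. \<forall>g\<in>Dspace \<mu>. ip (J f) (J g) = D_inner \<mu> f g"
    and N: "normal_op K add sm ip S" and SJ: "\<forall>f\<in>Dspace \<mu>. S (J f) = J (Mz (B f))"
    unfolding has_normal_extension_in_def by (elim exE conjE)
  from N obtain Sa where S: "bounded_op K add sm ip S" and Sa: "bounded_op K add sm ip Sa"
    and adj: "\<forall>x\<in>K. \<forall>y\<in>K. ip (S x) y = ip x (Sa y)"
    and comm: "\<forall>x\<in>K. S (Sa x) = Sa (S x)"
    unfolding normal_op_def by (elim exE conjE)
  interpret hilbert_normal K add sm zero ip S Sa
    by (rule hilbert_normal.intro[OF assms(7) S Sa]) (use adj comm in simp_all)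
  have D: "pfun (orbit n) \<in> Dspace \<mu>" for n
    unfolding assms(2) by (rule pfun_in_Dspace[OF orbit(1)])
  have step: "Mz (B (pfun (orbit n))) = pfun (orbit (Suc n))" for n
    using cauchy_dual_pfun[of A B, OF assms(3,4,6)[unfolded assms(2)] orbit] by (simp only: orbit.simps)
  define x where "x = J (pfun (orbit 0))"
  have x: "x \<in> K" using J D unfolding x_def by blast
  have "(S ^^ n) x = J (pfun (orbit n))" for n
  proof (induction n)
    case (Suc n)
    have "S (J (pfun (orbit n))) = J (pfun (orbit (Suc n)))" using SJ D step by metis
    then show ?case by (simp only: funpow.simps o_apply Suc)
  qed (simp only: x_def funpow.simps id_apply)
  then have sq: "sq ((S ^^ n) x) = nrm n" for n
    using ip D by (simp only: sq_def nrm_def assms(2))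
  \<comment> \<open>Index 1 is the first that can contradict: at index 0 the inequality amounts to
    \<open>1 + 9 * \<kappa> \<le> (1 + 3 * \<kappa>) * (1 + 6 * \<kappa>)\<close>, which is
    true.\<close>
  have "(nrm 2 - nrm 3)\<^sup>2 \<le> (nrm 1 - nrm 2) * (nrm 3 - nrm 4)"
    using sq_iter_drop_log_convex[OF x, of "nrm 0" 1, unfolded sq] nrm_le
    by (simp add: eval_nat_numeral)
  then show False using drops_not_log_convex by simp
qed

end
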